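(* Let $\langle \mathsf B,\mathcal F\rangle$ be a display map category with units and $\mathsf p:\mathsf E\to\mathsf B$ a dependent Skolem fibration over it. Let $g:A\twoheadrightarrow S$ and $f:B\twoheadrightarrow A$ be maps in $\mathcal F$. Consider the $\mathcal F$-dependent product of $f$ along $g$, given by $h:X\twoheadrightarrow S$ in $\mathcal F$, the pullback $Z=A\times_S X$ of $h$ along $g$ with projection $g':Z\twoheadrightarrow X$, and $e:Z\to B$ with $fe$ equal to the projection $Z\twoheadrightarrow A$. Then there is a vertical isomorphism $$\prod_g\coprod_f(\beta)\;\cong\;\coprod_h\prod_{g'}e^*(\beta)$$ for each $\beta\in\mathsf E_B$.
   Context: Fibrations $\mathsf p:\mathsf E\to\mathsf B$ are cloven Grothendieck fibrations; $\mathsf E_A$ is the fibre over $A$; vertical arrows are those over identities; $u^*$ is reindexing along $u$; canonical isomorphisms such as $g^*u^*\cong(ug)^*$ are suppressed. A display map category $\langle\mathsf B,\mathcal F\rangle$ is a category with a class $\mathcal F$ of morphisms such that pullbacks of $\mathcal F$-maps along arbitrary maps exist and lie in $\mathcal F$. Arrows of $\mathcal F$ are written $\twoheadrightarrow$. It has units if all isomorphisms of $\mathsf B$ are in $\mathcal F$. An $\mathcal F$-dependent product of $f:K\twoheadrightarrow I$ along $g:I\twoheadrightarrow J$ (both in $\mathcal F$) consists of $h:E\twoheadrightarrow J$ in $\mathcal F$, a pullback $Z=I\times_J E$ and $e:Z\to K$ over $I$, such that for every $h':E'\twoheadrightarrow J$ in $\mathcal F$ with pullback $Z'=I\times_J E'$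 and every $e':Z'\to K$ over $I$ there is a unique pair $w:Z'\to Z$, $k:E'\to E$ with $hk=h'$, $ew=e'$, and $w$ commuting with $k$ and with the projections of the pullbacks. $\mathsf B$ has $\mathcal F$-dependent products if these exist for all such pairs. $\mathsf p$ has $\mathcal F$-coproducts (resp. $\mathcal F$-products) if for each $v\in\mathcal F$ the functor $v^*$ has a left adjoint $\coprod_v$ (resp. right adjoint $\prod_v$), and for every pullback square with $v:L\twoheadrightarrow J$, $f:I\to J$ arbitrary, $u:K\twoheadrightarrow I$, $g:K\to L$, the canonical map $\coprod_u g^*\Rightarrow f^*\coprod_v$ (resp. $f^*\prod_v\Rightarrow\prod_u g^*$) is an isomorphism (Beck–Chevalley). $\alpha\in\mathsf E_A$ is $(\mathcal F,\coprod)$-quantifier splitting if for every $u:B\twoheadrightarrow A$ in $\mathcal F$, every $\beta\in\mathsf E_B$ and every vertical $h:\alpha\to\coprod_u\beta$ there exist a unique section $g:A\to B$ of $u$ and a unique vertical $\overline h:\alpha\to g^*\beta$ with $h=g^*(\eta_\beta)\circ\overline h$, where $\eta$ is the unit of $\coprod_u\dashv u^*$ and $g^*u^*\coprod_u\beta\cong\coprod_u\beta$. It is $(\mathcal F,\coprod)$-quantifier-free if $f^*\alpha$ is $(\mathcal F,\coprod)$-quantifier splitting for every $f:I\to A$ in $\mathsf B$. $\mathsf p$ has enough $(\mathcal F,\coprod)$-quantifier-free objects if it has $\mathcal F$-coproducts and for every $\alpha\in\mathsf E_I$ there are $f:A\twoheadrightarrow I$ in $\mathcal F$ and a $(\mathcal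 F,\coprod)$-quantifier-free $\beta\in\mathsf E_A$ with $\alpha\cong\coprod_f\beta$. $\mathsf p$ is a dependent Skolem fibration if: $\mathsf B$ has $\mathcal F$-dependent products; $\mathsf p$ has $\mathcal F$-products; $\mathsf p$ has enough $(\mathcal F,\coprod)$-quantifier-free objects (in particular it has $\mathcal F$-coproducts); and for each $(\mathcal F,\coprod)$-quantifier-free $\alpha\in\mathsf E_I$ and each $f:I\twoheadrightarrow J$ in $\mathcal F$, the object $\prod_f\alpha$ is $(\mathcal F,\coprod)$-quantifier-free. *)

theory Defs
  imports Main
begin

section \<open>Categories, functors, adjunctions\<close>

text \<open>\<open>g \<odot>\<^bsub>C\<^esub> f\<close> is "first \<open>f\<close>, then \<open>g\<close>"; it is meaningful only if the codomain of
  \<open>f\<close> is the domain of \<open>g\<close>. All operations are irrelevant outside the carriers.\<close>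

record ('o, 'a) cat =
  Obj :: "'o set"
  Arr :: "'a set"
  Dom :: "'a \<Rightarrow> 'o"
  Cod :: "'a \<Rightarrow> 'o"
  Idn :: "'o \<Rightarrow> 'a"
  Cmp :: "'a \<Rightarrow> 'a \<Rightarrow> 'a"  (infixl \<open>\<odot>\<index>\<close> 70)

definition hom :: "('o, 'a) cat \<Rightarrow> 'o \<Rightarrow> 'o \<Rightarrow> 'a set" where
  "hom C X Y = {f \<in> Arr C. Dom C f = X \<and> Cod C f = Y}"

locale category =
  fixes C :: "('o, 'a) cat" (structure)
  assumes Dom_closed: "f \<in> Arr C \<Longrightarrow> Dom C f \<in> Obj C"
    and Cod_closed: "f \<in> Arr C \<Longrightarrow> Cod C f \<in> Obj C"
    and Idn_hom: "X \<in> Obj C \<Longrightarrow> Idn C X \<in> hom C X X"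
    and Cmp_hom: "f \<in> hom C X Y \<Longrightarrow> g \<in> hom C Y Z \<Longrightarrow> g \<odot> f \<in> hom C X Z"
    and Idn_left: "f \<in> hom C X Y \<Longrightarrow> Idn C Y \<odot> f = f"
    and Idn_right: "f \<in> hom C X Y \<Longrightarrow> f \<odot> Idn C X = f"
    and Cmp_assoc: "f \<in> hom C W X \<Longrightarrow> g \<in> hom C X Y \<Longrightarrow> h \<in> hom C Y Z \<Longrightarrow>
      (h \<odot> g) \<odot> f = h \<odot> (g \<odot> f)"

definition inverse_arrows :: "('o, 'a) cat \<Rightarrow> 'a \<Rightarrow> 'a \<Rightarrow> bool" where
  "inverse_arrows C f g \<longleftrightarrow>
     f \<in> Arr C \<and> g \<in> hom C (Cod C f) (Dom C f) \<and>
     g \<odot>\<^bsub>C\<^esub> f = Idn C (Dom C f) \<and> f \<odot>\<^bsub>C\<^esub> g = Idn C (Cod C f)"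

definition is_iso :: "('o, 'a) cat \<Rightarrow> 'a \<Rightarrow> bool" where
  "is_iso C f \<longleftrightarrow> (\<exists>g. inverse_arrows C f g)"

definition inverse_arr :: "('o, 'a) cat \<Rightarrow> 'a \<Rightarrow> 'a" where
  "inverse_arr C f = (THE g. inverse_arrows C f g)"

definition isomorphic :: "('o, 'a) cat \<Rightarrow> 'o \<Rightarrow> 'o \<Rightarrow> bool" where
  "isomorphic C X Y \<longleftrightarrow> (\<exists>f \<in> hom C X Y. is_iso C f)"

record ('o, 'a, 'p, 'b) func =
  FObj :: "'o \<Rightarrow> 'p"
  FArr :: "'a \<Rightarrow> 'b"

definition id_func :: "('o, 'a, 'o, 'a) func" where
  "id_func = \<lparr>FObj = (\<lambda>X. X), FArr = (\<lambda>f. f)\<rparr>"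

definition comp_func ::
  "('p, 'b, 'q, 'c) func \<Rightarrow> ('o, 'a, 'p, 'b) func \<Rightarrow> ('o, 'a, 'q, 'c) func" where
  "comp_func S T = \<lparr>FObj = FObj S \<circ> FObj T, FArr = FArr S \<circ> FArr T\<rparr>"

definition is_functor :: "('o, 'a) cat \<Rightarrow> ('p, 'b) cat \<Rightarrow> ('o, 'a, 'p, 'b) func \<Rightarrow> bool" where
  "is_functor C D T \<longleftrightarrow>
     (\<forall>X \<in> Obj C. FObj T X \<in> Obj D) \<and>
     (\<forall>X Y. \<forall>f \<in> hom C X Y. FArr T f \<in> hom D (FObj T X) (FObj T Y)) \<and>
     (\<forall>X \<in> Obj C. FArr T (Idn C X) = Idn D (FObj T X)) \<and>
     (\<forall>X Y Z. \<forall>f \<in> hom C X Y. \<forall>g \<in> hom C Y Z.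
        FArr T (g \<odot>\<^bsub>C\<^esub> f) = FArr T g \<odot>\<^bsub>D\<^esub> FArr T f)"

definition nat_trans ::
  "('o, 'a) cat \<Rightarrow> ('p, 'b) cat \<Rightarrow> ('o, 'a, 'p, 'b) func \<Rightarrow> ('o, 'a, 'p, 'b) func \<Rightarrow>
   ('o \<Rightarrow> 'b) \<Rightarrow> bool" where
  "nat_trans C D S T \<tau> \<longleftrightarrow>
     (\<forall>X \<in> Obj C. \<tau> X \<in> hom D (FObj S X) (FObj T X)) \<and>
     (\<forall>X Y. \<forall>f \<in> hom C X Y. \<tau> Y \<odot>\<^bsub>D\<^esub> FArr S f = FArr T f \<odot>\<^bsub>D\<^esub> \<tau> X)"

text \<open>\<open>L \<stileturn> R\<close> with \<open>L : C \<rightarrow> D\<close>, unit \<open>\<eta> : 1 \<Rightarrow> RL\<close> and counit \<open>\<epsilon> : LR \<Rightarrow> 1\<close>.\<close>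

definition adjunction ::
  "('o, 'a) cat \<Rightarrow> ('p, 'b) cat \<Rightarrow> ('o, 'a, 'p, 'b) func \<Rightarrow> ('p, 'b, 'o, 'a) func \<Rightarrow>
   ('o \<Rightarrow> 'a) \<Rightarrow> ('p \<Rightarrow> 'b) \<Rightarrow> bool" where
  "adjunction C D L R \<eta> \<epsilon> \<longleftrightarrow>
     is_functor C D L \<and> is_functor D C R \<and>
     nat_trans C C id_func (comp_func R L) \<eta> \<and>
     nat_trans D D (comp_func L R) id_func \<epsilon> \<and>
     (\<forall>X \<in> Obj C. \<epsilon> (FObj L X) \<odot>\<^bsub>D\<^esub> FArr L (\<eta> X) = Idn D (FObj L X)) \<and>
     (\<forall>Y \<in> Obj D. FArr R (\<epsilon> Y) \<odot>\<^bsub>C\<^esub> \<eta> (FObj R Y) = Idn C (FObj R Y))"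


section \<open>Display map categories and dependent products\<close>

text \<open>The square with \<open>f : I \<rightarrow> J\<close>, \<open>v : L \<rightarrow> J\<close> and projections \<open>u : K \<rightarrow> I\<close>, \<open>g : K \<rightarrow> L\<close>.\<close>

definition is_pullback :: "('o, 'a) cat \<Rightarrow> 'a \<Rightarrow> 'a \<Rightarrow> 'a \<Rightarrow> 'a \<Rightarrow> bool" where
  "is_pullback C f v u g \<longleftrightarrow>
     f \<in> Arr C \<and> v \<in> Arr C \<and> Cod C f = Cod C v \<and>
     u \<in> hom C (Dom C u) (Dom C f) \<and> g \<in> hom C (Dom C u) (Dom C v) \<and>
     f \<odot>\<^bsub>C\<^esub> u = v \<odot>\<^bsub>C\<^esub> g \<and>
     (\<forall>W. \<forall>a \<in> hom C W (Dom C f). \<forall>b \<in> hom C W (Dom C v).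
        f \<odot>\<^bsub>C\<^esub> a = v \<odot>\<^bsub>C\<^esub> b \<longrightarrow>
        (\<exists>!w. w \<in> hom C W (Dom C u) \<and> u \<odot>\<^bsub>C\<^esub> w = a \<and> g \<odot>\<^bsub>C\<^esub> w = b))"

locale display_map_category = category C
  for C :: "('o, 'a) cat" (structure) +
  fixes \<F> :: "'a set"
  assumes \<F>_arr: "\<F> \<subseteq> Arr C"
    and pullback_exists: "v \<in> \<F> \<Longrightarrow> f \<in> Arr C \<Longrightarrow> Cod C f = Cod C v \<Longrightarrow>
      \<exists>u g. is_pullback C f v u g"
    and pullback_stable: "v \<in> \<F> \<Longrightarrow> is_pullback C f v u g \<Longrightarrow> u \<in> \<F>"

locale display_map_category_with_units = display_map_category +
  assumes units: "is_iso C i \<Longrightarrow> i \<in> \<F>"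

text \<open>\<open>h : E \<rightarrow> J\<close>, \<open>z1 : Z \<rightarrow> I\<close>, \<open>z2 : Z \<rightarrow> E\<close>, \<open>e : Z \<rightarrow> K\<close> form a dependent product of
  \<open>f : K \<rightarrow> I\<close> along \<open>g : I \<rightarrow> J\<close>.\<close>

definition is_dependent_product ::
  "('o, 'a) cat \<Rightarrow> 'a set \<Rightarrow> 'a \<Rightarrow> 'a \<Rightarrow> 'a \<Rightarrow> 'a \<Rightarrow> 'a \<Rightarrow> 'a \<Rightarrow> bool" where
  "is_dependent_product C \<F> f g h z1 z2 e \<longleftrightarrow>
     h \<in> \<F> \<and> is_pullback C g h z1 z2 \<and>
     e \<in> hom C (Dom C z1) (Dom C f) \<and> f \<odot>\<^bsub>C\<^esub> e = z1 \<and>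
     (\<forall>h' z1' z2' e'.
        h' \<in> \<F> \<longrightarrow> is_pullback C g h' z1' z2' \<longrightarrow>
        e' \<in> hom C (Dom C z1') (Dom C f) \<longrightarrow> f \<odot>\<^bsub>C\<^esub> e' = z1' \<longrightarrow>
        (\<exists>!(w, k). w \<in> hom C (Dom C z1') (Dom C z1) \<and> k \<in> hom C (Dom C h') (Dom C h) \<and>
           h \<odot>\<^bsub>C\<^esub> k = h' \<and> e \<odot>\<^bsub>C\<^esub> w = e' \<and>
           z1 \<odot>\<^bsub>C\<^esub> w = z1' \<and> z2 \<odot>\<^bsub>C\<^esub> w = k \<odot>\<^bsub>C\<^esub> z2'))"

definition has_dependent_products :: "('o, 'a) cat \<Rightarrow> 'a set \<Rightarrow> bool" where
  "has_dependent_products C \<F> \<longleftrightarrow>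
     (\<forall>f \<in> \<F>. \<forall>g \<in> \<F>. Cod C f = Dom C g \<longrightarrow>
        (\<exists>h z1 z2 e. is_dependent_product C \<F> f g h z1 z2 e))"


section \<open>Cloven fibrations\<close>

text \<open>\<open>Lift u X\<close> is the chosen cartesian arrow \<open>u\<^sup>*X \<rightarrow> X\<close> over \<open>u\<close>.\<close>

record ('bo, 'ba, 'eo, 'ea) fib =
  Bas :: "('bo, 'ba) cat"
  Tot :: "('eo, 'ea) cat"
  Prj :: "('eo, 'ea, 'bo, 'ba) func"
  Lift :: "'ba \<Rightarrow> 'eo \<Rightarrow> 'ea"

definition cartesian :: "('bo, 'ba, 'eo, 'ea) fib \<Rightarrow> 'ea \<Rightarrow> bool" where
  "cartesian P \<phi> \<longleftrightarrow>
     \<phi> \<in> Arr (Tot P) \<and>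
     (\<forall>\<psi> w. \<psi> \<in> Arr (Tot P) \<longrightarrow> Cod (Tot P) \<psi> = Cod (Tot P) \<phi> \<longrightarrow>
        w \<in> hom (Bas P) (FObj (Prj P) (Dom (Tot P) \<psi>)) (FObj (Prj P) (Dom (Tot P) \<phi>)) \<longrightarrow>
        FArr (Prj P) \<phi> \<odot>\<^bsub>Bas P\<^esub> w = FArr (Prj P) \<psi> \<longrightarrow>
        (\<exists>!\<chi>. \<chi> \<in> hom (Tot P) (Dom (Tot P) \<psi>) (Dom (Tot P) \<phi>) \<and>
           FArr (Prj P) \<chi> = w \<and> \<phi> \<odot>\<^bsub>Tot P\<^esub> \<chi> = \<psi>))"

locale cloven_fibration =
  fixes P :: "('bo, 'ba, 'eo, 'ea) fib"
  assumes base_category: "category (Bas P)"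
    and total_category: "category (Tot P)"
    and proj_functor: "is_functor (Tot P) (Bas P) (Prj P)"
    and Lift_cod: "u \<in> Arr (Bas P) \<Longrightarrow> X \<in> Obj (Tot P) \<Longrightarrow> FObj (Prj P) X = Cod (Bas P) u \<Longrightarrow>
      Cod (Tot P) (Lift P u X) = X"
    and Lift_over: "u \<in> Arr (Bas P) \<Longrightarrow> X \<in> Obj (Tot P) \<Longrightarrow> FObj (Prj P) X = Cod (Bas P) u \<Longrightarrow>
      FArr (Prj P) (Lift P u X) = u"
    and Lift_cartesian:
      "u \<in> Arr (Bas P) \<Longrightarrow> X \<in> Obj (Tot P) \<Longrightarrow> FObj (Prj P) X = Cod (Bas P) u \<Longrightarrow>
      cartesian P (Lift P u X)"

definition fibre :: "('bo, 'ba, 'eo, 'ea) fib \<Rightarrow> 'bo \<Rightarrow> ('eo, 'ea) cat" where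
  "fibre P A = \<lparr>
     Obj = {X \<in> Obj (Tot P). FObj (Prj P) X = A},
     Arr = {\<phi> \<in> Arr (Tot P). FArr (Prj P) \<phi> = Idn (Bas P) A},
     Dom = Dom (Tot P), Cod = Cod (Tot P), Idn = Idn (Tot P), Cmp = Cmp (Tot P)\<rparr>"

definition reindex_obj :: "('bo, 'ba, 'eo, 'ea) fib \<Rightarrow> 'ba \<Rightarrow> 'eo \<Rightarrow> 'eo" where
  "reindex_obj P u X = Dom (Tot P) (Lift P u X)"

definition reindex_arr :: "('bo, 'ba, 'eo, 'ea) fib \<Rightarrow> 'ba \<Rightarrow> 'ea \<Rightarrow> 'ea" where
  "reindex_arr P u \<phi> = (THE \<psi>.
     \<psi> \<in> hom (fibre P (Dom (Bas P) u))
            (reindex_obj P u (Dom (Tot P) \<phi>)) (reindex_obj P u (Cod (Tot P) \<phi>)) \<and>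
     Lift P u (Cod (Tot P) \<phi>) \<odot>\<^bsub>Tot P\<^esub> \<psi> = \<phi> \<odot>\<^bsub>Tot P\<^esub> Lift P u (Dom (Tot P) \<phi>))"

definition reindex :: "('bo, 'ba, 'eo, 'ea) fib \<Rightarrow> 'ba \<Rightarrow> ('eo, 'ea, 'eo, 'ea) func" where
  "reindex P u = \<lparr>FObj = reindex_obj P u, FArr = reindex_arr P u\<rparr>"

text \<open>The canonical isomorphism \<open>g\<^sup>*u\<^sup>*X \<rightarrow> (ug)\<^sup>*X\<close>. The canonical \<open>id\<^sup>*X \<rightarrow> X\<close> is
  \<open>Lift P (Idn (Bas P) A) X\<close> itself.\<close>

definition reindex_comp :: "('bo, 'ba, 'eo, 'ea) fib \<Rightarrow> 'ba \<Rightarrow> 'ba \<Rightarrow> 'eo \<Rightarrow> 'ea" where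
  "reindex_comp P u g X = (THE \<kappa>.
     \<kappa> \<in> hom (fibre P (Dom (Bas P) g))
            (reindex_obj P g (reindex_obj P u X)) (reindex_obj P (u \<odot>\<^bsub>Bas P\<^esub> g) X) \<and>
     Lift P (u \<odot>\<^bsub>Bas P\<^esub> g) X \<odot>\<^bsub>Tot P\<^esub> \<kappa> =
       Lift P u X \<odot>\<^bsub>Tot P\<^esub> Lift P g (reindex_obj P u X))"

text \<open>\<open>g\<^sup>*v\<^sup>*X \<rightarrow> (vg)\<^sup>*X = (fu)\<^sup>*X \<rightarrow> u\<^sup>*f\<^sup>*X\<close> for a commutative square \<open>vg = fu\<close>.\<close>

definition reindex_swap :: "('bo, 'ba, 'eo, 'ea) fib \<Rightarrow> 'ba \<Rightarrow> 'ba \<Rightarrow> 'ba \<Rightarrow> 'ba \<Rightarrow> 'eo \<Rightarrow> 'ea" where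
  "reindex_swap P v g f u X =
     inverse_arr (fibre P (Dom (Bas P) u)) (reindex_comp P f u X) \<odot>\<^bsub>Tot P\<^esub> reindex_comp P v g X"

text \<open>\<open>g\<^sup>*u\<^sup>*X \<rightarrow> (ug)\<^sup>*X = id\<^sup>*X \<rightarrow> X\<close> for a section \<open>g\<close> of \<open>u\<close>.\<close>

definition reindex_section :: "('bo, 'ba, 'eo, 'ea) fib \<Rightarrow> 'ba \<Rightarrow> 'ba \<Rightarrow> 'eo \<Rightarrow> 'ea" where
  "reindex_section P u g X =
     Lift P (Idn (Bas P) (Cod (Bas P) u)) X \<odot>\<^bsub>Tot P\<^esub> reindex_comp P u g X"


section \<open>Coproducts and products along display maps\<close>

text \<open>For each display map, a chosen left (or right) adjoint of reindexing with its unit and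
  counit. As usual, the properties below do not depend on the choice.\<close>

record ('eo, 'ea) adj =
  Adj :: "('eo, 'ea, 'eo, 'ea) func"
  Unit :: "'eo \<Rightarrow> 'ea"
  Counit :: "'eo \<Rightarrow> 'ea"

text \<open>\<open>\<Coprod>\<^sub>u g\<^sup>*\<beta> \<rightarrow> f\<^sup>* \<Coprod>\<^sub>v \<beta>\<close>, the transpose of
  \<open>g\<^sup>*\<beta> \<rightarrow> g\<^sup>* v\<^sup>* \<Coprod>\<^sub>v \<beta> \<cong> u\<^sup>* f\<^sup>* \<Coprod>\<^sub>v \<beta>\<close>.\<close>

definition coprod_bc ::
  "('bo, 'ba, 'eo, 'ea) fib \<Rightarrow> ('ba \<Rightarrow> ('eo, 'ea) adj) \<Rightarrow> 'ba \<Rightarrow> 'ba \<Rightarrow> 'ba \<Rightarrow> 'ba \<Rightarrow> 'eo \<Rightarrow> 'ea" where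
  "coprod_bc P \<Sigma> f v u g \<beta> =
     (let Y = FObj (Adj (\<Sigma> v)) \<beta> in
      Counit (\<Sigma> u) (reindex_obj P f Y) \<odot>\<^bsub>Tot P\<^esub>
      FArr (Adj (\<Sigma> u))
        (reindex_swap P v g f u Y \<odot>\<^bsub>Tot P\<^esub> reindex_arr P g (Unit (\<Sigma> v) \<beta>)))"

text \<open>\<open>f\<^sup>* \<Prod>\<^sub>v \<beta> \<rightarrow> \<Prod>\<^sub>u g\<^sup>*\<beta>\<close>, the transpose of
  \<open>u\<^sup>* f\<^sup>* \<Prod>\<^sub>v \<beta> \<cong> g\<^sup>* v\<^sup>* \<Prod>\<^sub>v \<beta> \<rightarrow> g\<^sup>*\<beta>\<close>.\<close>

definition prod_bc ::
  "('bo, 'ba, 'eo, 'ea) fib \<Rightarrow> ('ba \<Rightarrow> ('eo, 'ea) adj) \<Rightarrow> 'ba \<Rightarrow> 'ba \<Rightarrow> 'ba \<Rightarrow> 'ba \<Rightarrow> 'eo \<Rightarrow> 'ea" where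
  "prod_bc P \<Pi> f v u g \<beta> =
     (let Y = FObj (Adj (\<Pi> v)) \<beta> in
      FArr (Adj (\<Pi> u))
        (reindex_arr P g (Counit (\<Pi> v) \<beta>) \<odot>\<^bsub>Tot P\<^esub> reindex_swap P f u v g Y) \<odot>\<^bsub>Tot P\<^esub>
      Unit (\<Pi> u) (reindex_obj P f Y))"

definition is_coproducts ::
  "('bo, 'ba, 'eo, 'ea) fib \<Rightarrow> 'ba set \<Rightarrow> ('ba \<Rightarrow> ('eo, 'ea) adj) \<Rightarrow> bool" where
  "is_coproducts P \<F> \<Sigma> \<longleftrightarrow>
     (\<forall>v \<in> \<F>. adjunction (fibre P (Dom (Bas P) v)) (fibre P (Cod (Bas P) v))
        (Adj (\<Sigma> v)) (reindex P v) (Unit (\<Sigma> v)) (Counit (\<Sigma> v))) \<and>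
     (\<forall>f v u g. v \<in> \<F> \<longrightarrow> u \<in> \<F> \<longrightarrow> is_pullback (Bas P) f v u g \<longrightarrow>
        (\<forall>\<beta> \<in> Obj (fibre P (Dom (Bas P) v)).
           is_iso (fibre P (Dom (Bas P) f)) (coprod_bc P \<Sigma> f v u g \<beta>)))"

definition is_products ::
  "('bo, 'ba, 'eo, 'ea) fib \<Rightarrow> 'ba set \<Rightarrow> ('ba \<Rightarrow> ('eo, 'ea) adj) \<Rightarrow> bool" where
  "is_products P \<F> \<Pi> \<longleftrightarrow>
     (\<forall>v \<in> \<F>. adjunction (fibre P (Cod (Bas P) v)) (fibre P (Dom (Bas P) v))
        (reindex P v) (Adj (\<Pi> v)) (Unit (\<Pi> v)) (Counit (\<Pi> v))) \<and>
     (\<forall>f v u g. v \<in> \<F> \<longrightarrow> u \<in> \<F> \<longrightarrow> is_pullback (Bas P) f v u g \<longrightarrow>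
        (\<forall>\<beta> \<in> Obj (fibre P (Dom (Bas P) v)).
           is_iso (fibre P (Dom (Bas P) f)) (prod_bc P \<Pi> f v u g \<beta>)))"


section \<open>Quantifier-free objects and dependent Skolem fibrations\<close>

text \<open>The pair consisting of the section and the vertical arrow is unique.\<close>

definition quantifier_splitting ::
  "('bo, 'ba, 'eo, 'ea) fib \<Rightarrow> 'ba set \<Rightarrow> ('ba \<Rightarrow> ('eo, 'ea) adj) \<Rightarrow> 'bo \<Rightarrow> 'eo \<Rightarrow> bool" where
  "quantifier_splitting P \<F> \<Sigma> A \<alpha> \<longleftrightarrow>
     \<alpha> \<in> Obj (fibre P A) \<and>
     (\<forall>B u \<beta> h. u \<in> \<F> \<longrightarrow> u \<in> hom (Bas P) B A \<longrightarrow> \<beta> \<in> Obj (fibre P B) \<longrightarrow>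
        h \<in> hom (fibre P A) \<alpha> (FObj (Adj (\<Sigma> u)) \<beta>) \<longrightarrow>
        (\<exists>!(g, h'). g \<in> hom (Bas P) A B \<and> u \<odot>\<^bsub>Bas P\<^esub> g = Idn (Bas P) A \<and>
           h' \<in> hom (fibre P A) \<alpha> (reindex_obj P g \<beta>) \<and>
           h = reindex_section P u g (FObj (Adj (\<Sigma> u)) \<beta>) \<odot>\<^bsub>Tot P\<^esub>
               reindex_arr P g (Unit (\<Sigma> u) \<beta>) \<odot>\<^bsub>Tot P\<^esub> h'))"

definition quantifier_free ::
  "('bo, 'ba, 'eo, 'ea) fib \<Rightarrow> 'ba set \<Rightarrow> ('ba \<Rightarrow> ('eo, 'ea) adj) \<Rightarrow> 'bo \<Rightarrow> 'eo \<Rightarrow> bool" where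
  "quantifier_free P \<F> \<Sigma> A \<alpha> \<longleftrightarrow>
     \<alpha> \<in> Obj (fibre P A) \<and>
     (\<forall>I. \<forall>f \<in> hom (Bas P) I A. quantifier_splitting P \<F> \<Sigma> I (reindex_obj P f \<alpha>))"

definition enough_quantifier_free ::
  "('bo, 'ba, 'eo, 'ea) fib \<Rightarrow> 'ba set \<Rightarrow> ('ba \<Rightarrow> ('eo, 'ea) adj) \<Rightarrow> bool" where
  "enough_quantifier_free P \<F> \<Sigma> \<longleftrightarrow>
     is_coproducts P \<F> \<Sigma> \<and>
     (\<forall>I \<in> Obj (Bas P). \<forall>\<alpha> \<in> Obj (fibre P I). \<exists>A f \<beta>.
        f \<in> \<F> \<and> f \<in> hom (Bas P) A I \<and> quantifier_free P \<F> \<Sigma> A \<beta> \<and>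
        isomorphic (fibre P I) \<alpha> (FObj (Adj (\<Sigma> f)) \<beta>))"

locale dependent_skolem_fibration = cloven_fibration P
  for P :: "('bo, 'ba, 'eo, 'ea) fib" +
  fixes \<F> :: "'ba set"
    and \<Sigma> \<Pi> :: "'ba \<Rightarrow> ('eo, 'ea) adj"
  assumes dependent_products: "has_dependent_products (Bas P) \<F>"
    and products: "is_products P \<F> \<Pi>"
    and enough_qf: "enough_quantifier_free P \<F> \<Sigma>"
    and products_qf: "f \<in> \<F> \<Longrightarrow> f \<in> hom (Bas P) I J \<Longrightarrow> quantifier_free P \<F> \<Sigma> I \<alpha> \<Longrightarrow>
      quantifier_free P \<F> \<Sigma> J (FObj (Adj (\<Pi> f)) \<alpha>)"

end

theory Submission
  imports Defs
begin

text \<open>An object \<open>\<delta>\<close> is quantifier splitting iff every vertical arrow \<open>\<delta> \<rightarrow> \<Coprod>\<^sub>u \<beta>\<close> factors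
  uniquely, in the total category, through the canonical arrow \<open>\<iota> : \<beta> \<rightarrow> \<Coprod>\<^sub>u \<beta>\<close> over \<open>u\<close>; by
  Beck--Chevalley this extends to non-vertical arrows, which makes the coherence isomorphisms of
  reindexing disappear. Let \<open>\<delta>\<close> be quantifier-free over \<open>D\<close>, let \<open>k : D \<rightarrow> S\<close> be a display map,
  \<open>K = A \<times>\<^sub>S D\<close> and \<open>u : K \<rightarrow> D\<close>. Arrows \<open>\<delta> \<rightarrow> \<Prod>\<^sub>g \<Coprod>\<^sub>f \<beta>\<close> over \<open>k\<close> correspond to arrows
  \<open>u\<^sup>*\<delta> \<rightarrow> \<Coprod>\<^sub>f \<beta>\<close> over \<open>K \<rightarrow> A\<close>, hence to arrows \<open>u\<^sup>*\<delta> \<rightarrow> \<beta>\<close> over some \<open>e' : K \<rightarrow> B\<close> above \<open>A\<close>. By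
  the dependent product, \<open>e'\<close> amounts to \<open>\<kappa> : D \<rightarrow> X\<close> over \<open>S\<close> together with \<open>w : K \<rightarrow> Z\<close>,
  \<open>e w = e'\<close>, so these are the arrows \<open>\<delta> \<rightarrow> \<Prod>\<^sub>g\<^sub>' e\<^sup>*\<beta>\<close> over such \<open>\<kappa>\<close>, i.e. the arrows
  \<open>\<delta> \<rightarrow> \<Coprod>\<^sub>h \<Prod>\<^sub>g\<^sub>' e\<^sup>*\<beta>\<close> over \<open>k\<close>. The bijection is composition with one canonical vertical arrow, and
  every object is isomorphic to some \<open>\<Coprod>\<^sub>k \<delta>\<close>, so that arrow is invertible.\<close>

text \<open>Quantifier splitting and dependent products are both stated as unique existence of a
  pair. This rule splits the pair into two variables, so that uniqueness can be applied
  componentwise.\<close>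

lemma ex1_pairE:
  assumes "\<exists>!(x, y). Q x y"
  obtains x y where "Q x y" "\<forall>x' y'. Q x' y' \<longrightarrow> x' = x \<and> y' = y"
proof -
  from assms obtain z where z: "case_prod Q z" "\<And>z'. case_prod Q z' \<Longrightarrow> z' = z" by blast
  show thesis
  proof (rule that[of "fst z" "snd z"])
    show "Q (fst z) (snd z)" using z(1) by (simp add: case_prod_beta)
    show "\<forall>x' y'. Q x' y' \<longrightarrow> x' = fst z \<and> y' = snd z"
      using z(2)[of "(_, _)"] by fastforce
  qed
qed

section \<open>Categories and adjunctions\<close>

lemma (in category) homD:
  assumes "f \<in> hom C X Y"
  shows "f \<in> Arr C" "Dom C f = X" "Cod C f = Y" "X \<in> Obj C" "Y \<in> Obj C"
  using assms Dom_closed Cod_closed by (auto simp: hom_def)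

lemma (in category) ArrD: "f \<in> Arr C \<Longrightarrow> f \<in> hom C (Dom C f) (Cod C f)"
  by (simp add: hom_def)

lemma functorD:
  assumes "is_functor C D T"
  shows "X \<in> Obj C \<Longrightarrow> FObj T X \<in> Obj D"
    and "f \<in> hom C X Y \<Longrightarrow> FArr T f \<in> hom D (FObj T X) (FObj T Y)"
    and "X \<in> Obj C \<Longrightarrow> FArr T (Idn C X) = Idn D (FObj T X)"
    and "f \<in> hom C X Y \<Longrightarrow> g \<in> hom C Y Z \<Longrightarrow> FArr T (g \<odot>\<^bsub>C\<^esub> f) = FArr T g \<odot>\<^bsub>D\<^esub> FArr T f"
  using assms unfolding is_functor_def by blast+

lemma adjunctionD:
  assumes "adjunction C D L R \<eta> \<epsilon>"
  shows "is_functor C D L" "is_functor D C R"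
    and "X \<in> Obj C \<Longrightarrow> \<eta> X \<in> hom C X (FObj R (FObj L X))"
    and "Y \<in> Obj D \<Longrightarrow> \<epsilon> Y \<in> hom D (FObj L (FObj R Y)) Y"
    and "f \<in> hom C X X' \<Longrightarrow> \<eta> X' \<odot>\<^bsub>C\<^esub> f = FArr R (FArr L f) \<odot>\<^bsub>C\<^esub> \<eta> X"
    and "k \<in> hom D Y Y' \<Longrightarrow> \<epsilon> Y' \<odot>\<^bsub>D\<^esub> FArr L (FArr R k) = k \<odot>\<^bsub>D\<^esub> \<epsilon> Y"
    and "X \<in> Obj C \<Longrightarrow> \<epsilon> (FObj L X) \<odot>\<^bsub>D\<^esub> FArr L (\<eta> X) = Idn D (FObj L X)"
    and "Y \<in> Obj D \<Longrightarrow> FArr R (\<epsilon> Y) \<odot>\<^bsub>C\<^esub> \<eta> (FObj R Y) = Idn C (FObj R Y)"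
  using assms unfolding adjunction_def nat_trans_def by (auto simp: id_func_def comp_func_def)

text \<open>One half of the hom-set bijection, from naturality of \<eta> and the triangle identity
  at \<open>Y\<close>. Reindexing plays \<open>R\<close> for coproducts and \<open>L\<close> for
  products, so this half and its dual below serve both.\<close>

lemma adjunction_transpose:
  assumes C: "category C" and D: "category D" and adj: "adjunction C D L R \<eta> \<epsilon>"
    and Y: "Y \<in> Obj D" and f: "f \<in> hom C X (FObj R Y)"
  shows "\<epsilon> Y \<odot>\<^bsub>D\<^esub> FArr L f \<in> hom D (FObj L X) Y"
    and "FArr R (\<epsilon> Y \<odot>\<^bsub>D\<^esub> FArr L f) \<odot>\<^bsub>C\<^esub> \<eta> X = f"
proof -
  interpret C: category C by fact
  interpret D: category D by fact
  note a = adjunctionD[OF adj]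
  note L = functorD[OF a(1)] and R = functorD[OF a(2)]
  have X: "X \<in> Obj C" using C.homD[OF f] by simp
  have Lf: "FArr L f \<in> hom D (FObj L X) (FObj L (FObj R Y))" by (rule L(2)[OF f])
  show "\<epsilon> Y \<odot>\<^bsub>D\<^esub> FArr L f \<in> hom D (FObj L X) Y"
    by (rule D.Cmp_hom[OF Lf a(4)[OF Y]])
  have RY: "FObj R Y \<in> Obj C" using R(1)[OF Y] .
  have "FArr R (\<epsilon> Y \<odot>\<^bsub>D\<^esub> FArr L f) \<odot>\<^bsub>C\<^esub> \<eta> X
      = (FArr R (\<epsilon> Y) \<odot>\<^bsub>C\<^esub> FArr R (FArr L f)) \<odot>\<^bsub>C\<^esub> \<eta> X"
    by (simp add: R(4)[OF Lf a(4)[OF Y]])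
  also have "\<dots> = FArr R (\<epsilon> Y) \<odot>\<^bsub>C\<^esub> (\<eta> (FObj R Y) \<odot>\<^bsub>C\<^esub> f)"
    by (simp add: C.Cmp_assoc[OF a(3)[OF X] R(2)[OF Lf] R(2)[OF a(4)[OF Y]]] a(5)[OF f])
  also have "\<dots> = (FArr R (\<epsilon> Y) \<odot>\<^bsub>C\<^esub> \<eta> (FObj R Y)) \<odot>\<^bsub>C\<^esub> f"
    by (simp add: C.Cmp_assoc[OF f a(3)[OF RY] R(2)[OF a(4)[OF Y]]])
  also have "\<dots> = f" by (simp add: a(8)[OF Y] C.Idn_left[OF f])
  finally show "FArr R (\<epsilon> Y \<odot>\<^bsub>D\<^esub> FArr L f) \<odot>\<^bsub>C\<^esub> \<eta> X = f" .
qed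

lemma adjunction_cotranspose:
  assumes C: "category C" and D: "category D" and adj: "adjunction C D L R \<eta> \<epsilon>"
    and X: "X \<in> Obj C" and k: "k \<in> hom D (FObj L X) Y"
  shows "FArr R k \<odot>\<^bsub>C\<^esub> \<eta> X \<in> hom C X (FObj R Y)"
    and "\<epsilon> Y \<odot>\<^bsub>D\<^esub> FArr L (FArr R k \<odot>\<^bsub>C\<^esub> \<eta> X) = k"
proof -
  interpret C: category C by fact
  interpret D: category D by fact
  note a = adjunctionD[OF adj]
  note L = functorD[OF a(1)] and R = functorD[OF a(2)]
  have Y: "Y \<in> Obj D" using D.homD[OF k] by simp
  have Rk: "FArr R k \<in> hom C (FObj R (FObj L X)) (FObj R Y)" by (rule R(2)[OF k])
  show "FArr R k \<odot>\<^bsub>C\<^esub> \<eta> X \<in> hom C X (FObj R Y)"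
    by (rule C.Cmp_hom[OF a(3)[OF X] Rk])
  have LX: "FObj L X \<in> Obj D" using L(1)[OF X] .
  have "\<epsilon> Y \<odot>\<^bsub>D\<^esub> FArr L (FArr R k \<odot>\<^bsub>C\<^esub> \<eta> X)
      = (\<epsilon> Y \<odot>\<^bsub>D\<^esub> FArr L (FArr R k)) \<odot>\<^bsub>D\<^esub> FArr L (\<eta> X)"
    by (simp add: L(4)[OF a(3)[OF X] Rk] D.Cmp_assoc[OF L(2)[OF a(3)[OF X]] L(2)[OF Rk] a(4)[OF Y]])
  also have "\<dots> = k \<odot>\<^bsub>D\<^esub> (\<epsilon> (FObj L X) \<odot>\<^bsub>D\<^esub> FArr L (\<eta> X))"
    by (simp add: a(6)[OF k] D.Cmp_assoc[OF L(2)[OF a(3)[OF X]] a(4)[OF LX] k])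
  also have "\<dots> = k" by (simp add: a(7)[OF X] D.Idn_right[OF k])
  finally show "\<epsilon> Y \<odot>\<^bsub>D\<^esub> FArr L (FArr R k \<odot>\<^bsub>C\<^esub> \<eta> X) = k" .
qed

lemma is_pullback_sym:
  assumes "is_pullback C f v u g" shows "is_pullback C v f g u"
proof -
  have "Dom C g = Dom C u" using assms by (simp add: is_pullback_def hom_def)
  then show ?thesis using assms unfolding is_pullback_def by (auto simp: conj_commute)
qed

section \<open>Arrows over a base arrow\<close>

text \<open>The base arrow is kept explicit so that arrows can be compared by composition in the
  total category instead of through coherence isomorphisms. Vertical arrows are those over an
  identity.\<close>

definition hom_over :: "('bo, 'ba, 'eo, 'ea) fib \<Rightarrow> 'ba \<Rightarrow> 'eo \<Rightarrow> 'eo \<Rightarrow> 'ea set" where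
  "hom_over P u X Y = {\<phi> \<in> hom (Tot P) X Y. FArr (Prj P) \<phi> = u}"

lemma hom_fibre: "hom (fibre P A) X Y = hom_over P (Idn (Bas P) A) X Y"
  by (auto simp: hom_def hom_over_def fibre_def)

lemma fibre_simps [simp]:
  "Cmp (fibre P A) = Cmp (Tot P)" "Idn (fibre P A) = Idn (Tot P)"
  "Dom (fibre P A) = Dom (Tot P)" "Cod (fibre P A) = Cod (Tot P)"
  "X \<in> Obj (fibre P A) \<longleftrightarrow> X \<in> Obj (Tot P) \<and> FObj (Prj P) X = A"
  by (simp_all add: fibre_def)

lemma reindex_simps [simp]:
  "FObj (reindex P u) = reindex_obj P u" "FArr (reindex P u) = reindex_arr P u"
  by (simp_all add: reindex_def)

context cloven_fibration
begin

sublocale base: category "Bas P" by (rule base_category)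
sublocale total: category "Tot P" by (rule total_category)

abbreviation E where "E \<equiv> hom_over P"
abbreviation p where "p \<equiv> FObj (Prj P)"
abbreviation I where "I \<equiv> Idn (Bas P)"
abbreviation cmpT (infixl \<open>\<cdot>\<close> 70) where "\<psi> \<cdot> \<phi> \<equiv> \<psi> \<odot>\<^bsub>Tot P\<^esub> \<phi>"
abbreviation cmpB (infixl \<open>\<star>\<close> 70) where "v \<star> u \<equiv> v \<odot>\<^bsub>Bas P\<^esub> u"
abbreviation homB where "homB \<equiv> hom (Bas P)"

lemmas proj = functorD[OF proj_functor]

lemma overD:
  assumes "\<phi> \<in> E u X Y"
  shows "\<phi> \<in> hom (Tot P) X Y" "u \<in> homB (p X) (p Y)" "FArr (Prj P) \<phi> = u"
    "X \<in> Obj (Tot P)" "Y \<in> Obj (Tot P)" "p X \<in> Obj (Bas P)" "p Y \<in> Obj (Bas P)"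
  using assms proj(1,2) total.homD by (auto simp: hom_over_def)

lemma over_base_eq:
  assumes "\<phi> \<in> E u X Y" "u \<in> homB A B" shows "p X = A" "p Y = B"
  using overD(2)[OF assms(1)] assms(2) by (auto simp: hom_def)

lemma over_comp: "\<phi> \<in> E u X Y \<Longrightarrow> \<psi> \<in> E v Y Z \<Longrightarrow> \<psi> \<cdot> \<phi> \<in> E (v \<star> u) X Z"
  by (auto simp: hom_over_def proj(4) intro: total.Cmp_hom)

lemma over_comp': "\<phi> \<in> E u X Y \<Longrightarrow> \<psi> \<in> E v Y Z \<Longrightarrow> v \<star> u = w \<Longrightarrow> \<psi> \<cdot> \<phi> \<in> E w X Z"
  using over_comp by blast

lemma over_id: "X \<in> Obj (Tot P) \<Longrightarrow> p X = A \<Longrightarrow> Idn (Tot P) X \<in> E (I A) X X"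
  using proj(3) total.Idn_hom by (auto simp: hom_over_def)

lemma vertical_base:
  assumes "\<phi> \<in> E (I A) X Y" "A \<in> Obj (Bas P)" shows "p X = A" "p Y = A"
  using over_base_eq[OF assms(1) base.Idn_hom[OF assms(2)]] by auto

lemma vertical_comp_left:
  assumes "\<phi> \<in> E u X Y" "\<psi> \<in> E (I A) Y Z" "A \<in> Obj (Bas P)" shows "\<psi> \<cdot> \<phi> \<in> E u X Z"
proof -
  have "u \<in> homB (p X) A" using overD(2)[OF assms(1)] vertical_base[OF assms(2,3)] by simp
  then show ?thesis using over_comp'[OF assms(1,2)] base.Idn_left by blast
qed

lemma vertical_comp_right:
  assumes "\<phi> \<in> E (I A) X Y" "\<psi> \<in> E u Y Z" "A \<in> Obj (Bas P)" shows "\<psi> \<cdot> \<phi> \<in> E u X Z"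
proof -
  have "u \<in> homB A (p Z)" using overD(2)[OF assms(2)] vertical_base[OF assms(1,3)] by simp
  then show ?thesis using over_comp'[OF assms(1,2)] base.Idn_right by blast
qed

lemma assoc:
  "\<phi> \<in> E u W X \<Longrightarrow> \<psi> \<in> E v X Y \<Longrightarrow> \<chi> \<in> E w Y Z \<Longrightarrow> (\<chi> \<cdot> \<psi>) \<cdot> \<phi> = \<chi> \<cdot> (\<psi> \<cdot> \<phi>)"
  by (auto simp: hom_over_def intro: total.Cmp_assoc)

lemma id_left: "\<phi> \<in> E u X Y \<Longrightarrow> Idn (Tot P) Y \<cdot> \<phi> = \<phi>"
  and id_right: "\<phi> \<in> E u X Y \<Longrightarrow> \<phi> \<cdot> Idn (Tot P) X = \<phi>"
  by (auto simp: hom_over_def intro: total.Idn_left total.Idn_right)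

section \<open>Fibres as categories, and inverses in them\<close>

lemma fibre_category:
  assumes "A \<in> Obj (Bas P)" shows "category (fibre P A)"
proof
  fix f assume "f \<in> Arr (fibre P A)"
  then have "f \<in> E (I A) (Dom (Tot P) f) (Cod (Tot P) f)"
    by (auto simp: fibre_def hom_over_def intro: total.ArrD)
  then show "Dom (fibre P A) f \<in> Obj (fibre P A)" "Cod (fibre P A) f \<in> Obj (fibre P A)"
    using vertical_base[OF _ assms] overD by auto
next
  fix f X Y g Z assume "f \<in> hom (fibre P A) X Y" "g \<in> hom (fibre P A) Y Z"
  then show "g \<odot>\<^bsub>fibre P A\<^esub> f \<in> hom (fibre P A) X Z"
    by (auto simp: hom_fibre intro: vertical_comp_left assms)
qed (auto simp: hom_fibre id_left id_right assoc intro: over_id)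

lemma is_iso_fibreD:
  assumes "is_iso (fibre P A) b" "b \<in> E (I A) X Y"
  obtains c where "c \<in> E (I A) Y X" "c \<cdot> b = Idn (Tot P) X" "b \<cdot> c = Idn (Tot P) Y"
proof -
  have "Dom (Tot P) b = X" "Cod (Tot P) b = Y"
    using total.homD[OF overD(1)[OF assms(2)]] by auto
  then show ?thesis
    using assms(1) that by (auto simp: is_iso_def inverse_arrows_def hom_fibre)
qed

lemma inverse_arrows_fibreI:
  assumes "b \<in> E (I A) X Y" "c \<in> E (I A) Y X" "c \<cdot> b = Idn (Tot P) X" "b \<cdot> c = Idn (Tot P) Y"
  shows "inverse_arrows (fibre P A) b c"
proof -
  have "Dom (Tot P) b = X" "Cod (Tot P) b = Y" "b \<in> Arr (fibre P A)"
    using total.homD[OF overD(1)[OF assms(1)]] overD(3)[OF assms(1)] by (auto simp: fibre_def)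
  then show ?thesis using assms by (auto simp: inverse_arrows_def hom_fibre)
qed

text \<open>\<open>inverse_arr\<close> is a definite description occurring inside
  \<open>reindex_swap\<close>; uniqueness of inverses in the fibre evaluates it.\<close>

lemma inverse_arr_eq:
  assumes "b \<in> E (I A) X Y" "c \<in> E (I A) Y X" "c \<cdot> b = Idn (Tot P) X" "b \<cdot> c = Idn (Tot P) Y"
  shows "inverse_arr (fibre P A) b = c"
  unfolding inverse_arr_def
proof (rule the_equality)
  show "inverse_arrows (fibre P A) b c" by (rule inverse_arrows_fibreI[OF assms])
  fix d assume d: "inverse_arrows (fibre P A) b d"
  have "Dom (Tot P) b = X" "Cod (Tot P) b = Y"
    using total.homD[OF overD(1)[OF assms(1)]] by auto
  with d have d: "d \<in> E (I A) Y X" "d \<cdot> b = Idn (Tot P) X"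
    by (auto simp: inverse_arrows_def hom_fibre)
  have "d = d \<cdot> (b \<cdot> c)" by (simp add: assms(4) id_right[OF d(1)])
  also have "\<dots> = c" by (simp add: assoc[OF assms(2,1) d(1), symmetric] d(2) id_left[OF assms(2)])
  finally show "d = c" .
qed

section \<open>Cartesian arrows and reindexing\<close>

lemma cartesian_factor:
  assumes "cartesian P \<phi>" "\<phi> \<in> E u X Y" "w \<in> homB (p W) (p X)" "\<psi> \<in> E (u \<star> w) W Y"
  shows "\<exists>!\<chi>. \<chi> \<in> E w W X \<and> \<phi> \<cdot> \<chi> = \<psi>"
proof -
  have *: "Dom (Tot P) \<phi> = X" "Cod (Tot P) \<phi> = Y" "Dom (Tot P) \<psi> = W" "Cod (Tot P) \<psi> = Y"
    "\<psi> \<in> Arr (Tot P)" "FArr (Prj P) \<phi> = u" "FArr (Prj P) \<psi> = u \<star> w"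
    using total.homD[OF overD(1)[OF assms(2)]] total.homD[OF overD(1)[OF assms(4)]]
      overD(3)[OF assms(2)] overD(3)[OF assms(4)] by auto
  have "\<exists>!\<chi>. \<chi> \<in> hom (Tot P) W X \<and> FArr (Prj P) \<chi> = w \<and> \<phi> \<cdot> \<chi> = \<psi>"
    using assms(1,3) * unfolding cartesian_def by metis
  then show ?thesis by (simp add: hom_over_def)
qed

lemma cartesian_factorE:
  assumes "cartesian P \<phi>" "\<phi> \<in> E u X Y" "w \<in> homB (p W) (p X)" "\<psi> \<in> E (u \<star> w) W Y"
  obtains \<chi> where "\<chi> \<in> E w W X" "\<phi> \<cdot> \<chi> = \<psi>"
  using cartesian_factor[OF assms] by blast

lemma cartesian_cancel:
  assumes "cartesian P \<phi>" "\<phi> \<in> E u X Y" "\<chi> \<in> E w W X" "\<chi>' \<in> E w W X" "\<phi> \<cdot> \<chi> = \<phi> \<cdot> \<chi>'"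
  shows "\<chi> = \<chi>'"
  using cartesian_factor[OF assms(1,2) overD(2)[OF assms(3)] over_comp[OF assms(3,2)]]
    assms(3-5) by auto

lemma lift:
  assumes "X \<in> Obj (Tot P)" "u \<in> homB B (p X)"
  shows "Lift P u X \<in> E u (reindex_obj P u X) X" "cartesian P (Lift P u X)"
    "reindex_obj P u X \<in> Obj (Tot P)" "p (reindex_obj P u X) = B"
proof -
  have u: "u \<in> Arr (Bas P)" "p X = Cod (Bas P) u" using base.homD[OF assms(2)] by auto
  show c: "cartesian P (Lift P u X)" using Lift_cartesian[OF u(1) assms(1) u(2)] .
  then have "Lift P u X \<in> Arr (Tot P)" by (simp add: cartesian_def)
  then show E: "Lift P u X \<in> E u (reindex_obj P u X) X"
    using Lift_cod[OF u(1) assms(1) u(2)] Lift_over[OF u(1) assms(1) u(2)]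
    by (simp add: hom_over_def hom_def reindex_obj_def)
  show "reindex_obj P u X \<in> Obj (Tot P)" "p (reindex_obj P u X) = B"
    using overD(4)[OF E] over_base_eq(1)[OF E assms(2)] by auto
qed

text \<open>Cartesianness of the lift of \<open>v\<close> factors
  \<open>\<phi> \<cdot> Lift P u X\<close> through it. Identities for \<open>f\<close> and
  \<open>g\<close> give the action of reindexing on vertical arrows; general squares give the
  transposes used for products.\<close>

lemma base_change:
  assumes "\<phi> \<in> E f X Y" "u \<in> homB K (p X)" "v \<in> homB L (p Y)" "g \<in> homB K L" "f \<star> u = v \<star> g"
  shows "\<exists>!\<psi>. \<psi> \<in> E g (reindex_obj P u X) (reindex_obj P v Y) \<and> Lift P v Y \<cdot> \<psi> = \<phi> \<cdot> Lift P u X"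
proof -
  note X = lift[OF overD(4)[OF assms(1)] assms(2)] and Y = lift[OF overD(5)[OF assms(1)] assms(3)]
  have "\<phi> \<cdot> Lift P u X \<in> E (v \<star> g) (reindex_obj P u X) Y"
    by (rule over_comp'[OF X(1) assms(1,5)])
  then show ?thesis using cartesian_factor[OF Y(2,1), of g] assms(4) X(4) Y(4) by simp
qed

lemma reindex_arr:
  assumes "\<phi> \<in> E (I A) X Y" "u \<in> homB B A"
  shows "reindex_arr P u \<phi> \<in> E (I B) (reindex_obj P u X) (reindex_obj P u Y)"
    "Lift P u Y \<cdot> reindex_arr P u \<phi> = \<phi> \<cdot> Lift P u X"
proof -
  have A: "A \<in> Obj (Bas P)" and B: "B \<in> Obj (Bas P)" using base.homD[OF assms(2)] by auto
  note XY = vertical_base[OF assms(1) A]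
  have "\<exists>!\<psi>. \<psi> \<in> E (I B) (reindex_obj P u X) (reindex_obj P u Y) \<and> Lift P u Y \<cdot> \<psi> = \<phi> \<cdot> Lift P u X"
    by (rule base_change[OF assms(1)])
      (use XY assms(2) base.Idn_hom[OF B] base.Idn_left base.Idn_right in auto)
  moreover have "Dom (Tot P) \<phi> = X" "Cod (Tot P) \<phi> = Y" "Dom (Bas P) u = B"
    using total.homD[OF overD(1)[OF assms(1)]] base.homD[OF assms(2)] by auto
  ultimately have "reindex_arr P u \<phi> \<in> E (I B) (reindex_obj P u X) (reindex_obj P u Y)
      \<and> Lift P u Y \<cdot> reindex_arr P u \<phi> = \<phi> \<cdot> Lift P u X"
    unfolding reindex_arr_def hom_fibre by (simp only:) (rule theI')
  then show "reindex_arr P u \<phi> \<in> E (I B) (reindex_obj P u X) (reindex_obj P u Y)"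
    "Lift P u Y \<cdot> reindex_arr P u \<phi> = \<phi> \<cdot> Lift P u X" by auto
qed

section \<open>Coherence isomorphisms of reindexing along composites and commuting squares\<close>

lemma reindex_comp:
  assumes X: "X \<in> Obj (Tot P)" and u: "u \<in> homB B (p X)" and g: "g \<in> homB K B"
  shows "reindex_comp P u g X \<in> E (I K) (reindex_obj P g (reindex_obj P u X)) (reindex_obj P (u \<star> g) X)"
    and "Lift P (u \<star> g) X \<cdot> reindex_comp P u g X = Lift P u X \<cdot> Lift P g (reindex_obj P u X)"
    and "\<exists>c. c \<in> E (I K) (reindex_obj P (u \<star> g) X) (reindex_obj P g (reindex_obj P u X)) \<and>
      c \<cdot> reindex_comp P u g X = Idn (Tot P) (reindex_obj P g (reindex_obj P u X)) \<and>
      reindex_comp P u g X \<cdot> c = Idn (Tot P) (reindex_obj P (u \<star> g) X)"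
proof -
  let ?Z = "reindex_obj P g (reindex_obj P u X)" and ?W = "reindex_obj P (u \<star> g) X"
  let ?k = "reindex_comp P u g X"
  have K: "K \<in> Obj (Bas P)" and K': "Dom (Bas P) g = K" using base.homD[OF g] by auto
  have ug: "u \<star> g \<in> homB K (p X)" using base.Cmp_hom[OF g u] .
  note L1 = lift[OF X u]
  note L2 = lift[OF L1(3), unfolded L1(4), OF g]
  note L3 = lift[OF X ug]
  note IK = base.Idn_hom[OF K]
  have LL: "Lift P u X \<cdot> Lift P g (reindex_obj P u X) \<in> E (u \<star> g) ?Z X"
    by (rule over_comp[OF L2(1) L1(1)])
  have "\<exists>!\<kappa>. \<kappa> \<in> E (I K) ?Z ?W \<and> Lift P (u \<star> g) X \<cdot> \<kappa> = Lift P u X \<cdot> Lift P g (reindex_obj P u X)"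
    by (rule cartesian_factor[OF L3(2,1)]) (use IK L2(4) L3(4) LL base.Idn_right[OF ug] in auto)
  from theI'[OF this] show k: "?k \<in> E (I K) ?Z ?W"
    and kL: "Lift P (u \<star> g) X \<cdot> ?k = Lift P u X \<cdot> Lift P g (reindex_obj P u X)"
    unfolding reindex_comp_def hom_fibre K' by auto
  \<comment> \<open>The inverse is built in two stages: the lift of the composite is factored
    through the lift of \<open>u\<close>, giving \<open>c0\<close> over \<open>g\<close>, and
    \<open>c0\<close> is then factored through the lift of \<open>g\<close>.\<close>
  obtain c0 where c0: "c0 \<in> E g ?W (reindex_obj P u X)" "Lift P u X \<cdot> c0 = Lift P (u \<star> g) X"
    using cartesian_factorE[OF L1(2,1) _ L3(1)] g L1(4) L3(4) by metis
  obtain c where c: "c \<in> E (I K) ?W ?Z" "Lift P g (reindex_obj P u X) \<cdot> c = c0"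
    using cartesian_factorE[OF L2(2,1), of "I K" ?W c0] c0(1) IK L2(4) L3(4) base.Idn_right[OF g] by metis
  have Lc: "(Lift P u X \<cdot> Lift P g (reindex_obj P u X)) \<cdot> c = Lift P (u \<star> g) X"
    by (simp add: assoc[OF c(1) L2(1) L1(1)] c c0)
  have ck: "c \<cdot> ?k = Idn (Tot P) ?Z"
  proof (rule cartesian_cancel[OF L2(2,1) vertical_comp_left[OF k c(1) K] over_id[OF L2(3,4)]])
    show "Lift P g (reindex_obj P u X) \<cdot> (c \<cdot> ?k) = Lift P g (reindex_obj P u X) \<cdot> Idn (Tot P) ?Z"
    proof (rule cartesian_cancel[OF L1(2,1)])
      show "Lift P g (reindex_obj P u X) \<cdot> (c \<cdot> ?k) \<in> E g ?Z (reindex_obj P u X)"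
        by (rule vertical_comp_right[OF vertical_comp_left[OF k c(1) K] L2(1) K])
      show "Lift P g (reindex_obj P u X) \<cdot> Idn (Tot P) ?Z \<in> E g ?Z (reindex_obj P u X)"
        using L2(1) id_right[OF L2(1)] by simp
      show "Lift P u X \<cdot> (Lift P g (reindex_obj P u X) \<cdot> (c \<cdot> ?k)) =
            Lift P u X \<cdot> (Lift P g (reindex_obj P u X) \<cdot> Idn (Tot P) ?Z)"
        by (simp add: id_right[OF L2(1)] assoc[OF k c(1) L2(1), symmetric] c(2)
            assoc[OF k c0(1) L1(1), symmetric] c0(2) kL)
    qed
  qed
  have kc: "?k \<cdot> c = Idn (Tot P) ?W"
    by (rule cartesian_cancel[OF L3(2,1) vertical_comp_left[OF c(1) k K] over_id[OF L3(3,4)]])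
      (simp add: id_right[OF L3(1)] assoc[OF c(1) k L3(1), symmetric] kL Lc)
  show "\<exists>c. c \<in> E (I K) ?W ?Z \<and> c \<cdot> ?k = Idn (Tot P) ?Z \<and> ?k \<cdot> c = Idn (Tot P) ?W"
    using c(1) ck kc by blast
qed

text \<open>The swap is the comparison for \<open>v \<star> g\<close> followed by the inverse of the
  one for \<open>f \<star> u\<close>. Composing with the lifts down to \<open>X\<close> cancels that
  inverse, so Beck--Chevalley maps can be computed with lifts alone.\<close>

lemma reindex_swap:
  assumes X: "X \<in> Obj (Tot P)" and v: "v \<in> homB L (p X)" and g: "g \<in> homB K L"
    and f: "f \<in> homB J (p X)" and u: "u \<in> homB K J" and eq: "f \<star> u = v \<star> g"
  shows "reindex_swap P v g f u X \<in> E (I K) (reindex_obj P g (reindex_obj P v X)) (reindex_obj P u (reindex_obj P f X))"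
    and "Lift P f X \<cdot> (Lift P u (reindex_obj P f X) \<cdot> reindex_swap P v g f u X)
       = Lift P v X \<cdot> Lift P g (reindex_obj P v X)"
proof -
  note a = reindex_comp[OF X v g] and b = reindex_comp[OF X f u]
  have K: "K \<in> Obj (Bas P)" and K': "Dom (Bas P) u = K" using base.homD[OF u] by auto
  note L1 = lift[OF X f]
  note L2 = lift[OF L1(3), unfolded L1(4), OF u]
  obtain c where c: "c \<in> E (I K) (reindex_obj P (f \<star> u) X) (reindex_obj P u (reindex_obj P f X))"
      "c \<cdot> reindex_comp P f u X = Idn (Tot P) (reindex_obj P u (reindex_obj P f X))"
      "reindex_comp P f u X \<cdot> c = Idn (Tot P) (reindex_obj P (f \<star> u) X)"
    using b(3) by blast
  have s: "reindex_swap P v g f u X = c \<cdot> reindex_comp P v g X"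
    unfolding reindex_swap_def K' using inverse_arr_eq[OF b(1) c] by simp
  have a1: "reindex_comp P v g X \<in> E (I K) (reindex_obj P g (reindex_obj P v X)) (reindex_obj P (f \<star> u) X)"
    using a(1) eq by simp
  show sE: "reindex_swap P v g f u X \<in> E (I K) (reindex_obj P g (reindex_obj P v X)) (reindex_obj P u (reindex_obj P f X))"
    unfolding s by (rule vertical_comp_left[OF a1 c(1) K])
  have L3: "Lift P (f \<star> u) X \<in> E (f \<star> u) (reindex_obj P (f \<star> u) X) X"
    by (rule lift(1)[OF X base.Cmp_hom[OF u f]])
  have "Lift P f X \<cdot> (Lift P u (reindex_obj P f X) \<cdot> reindex_swap P v g f u X)
      = (Lift P (f \<star> u) X \<cdot> reindex_comp P f u X) \<cdot> (c \<cdot> reindex_comp P v g X)"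
    using assoc[OF sE L2(1) L1(1)] by (simp add: b(2) s)
  also have "\<dots> = (Lift P (f \<star> u) X \<cdot> (reindex_comp P f u X \<cdot> c)) \<cdot> reindex_comp P v g X"
    by (simp add: assoc[OF a1 c(1) vertical_comp_right[OF b(1) L3 K], symmetric] assoc[OF c(1) b(1) L3])
  also have "\<dots> = Lift P v X \<cdot> Lift P g (reindex_obj P v X)"
    using a(2) id_right[OF L3] by (simp add: c(3) eq)
  finally show "Lift P f X \<cdot> (Lift P u (reindex_obj P f X) \<cdot> reindex_swap P v g f u X)
       = Lift P v X \<cdot> Lift P g (reindex_obj P v X)" .
qed

lemma reindex_section:
  assumes X: "X \<in> Obj (Tot P)" and u: "u \<in> homB B (p X)" and g: "g \<in> homB (p X) B"
    and eq: "u \<star> g = I (p X)"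
  shows "reindex_section P u g X = Lift P u X \<cdot> Lift P g (reindex_obj P u X)"
  using reindex_comp(2)[OF X u g] base.homD(3)[OF u] by (simp add: reindex_section_def eq)

lemma lift_factor:
  assumes "\<phi> \<in> E r W X" "r = u \<star> w" "u \<in> homB B (p X)" "w \<in> homB (p W) B"
  obtains \<chi> where "\<chi> \<in> E w W (reindex_obj P u X)" "Lift P u X \<cdot> \<chi> = \<phi>"
proof -
  note X = lift[OF overD(5)[OF assms(1)] assms(3)]
  show ?thesis by (rule cartesian_factorE[OF X(2,1)]) (use assms X(4) that in auto)
qed

lemma lift_cancel:
  assumes "X \<in> Obj (Tot P)" "u \<in> homB B (p X)"
    "\<chi> \<in> E w W (reindex_obj P u X)" "\<chi>' \<in> E w W (reindex_obj P u X)"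
    "Lift P u X \<cdot> \<chi> = Lift P u X \<cdot> \<chi>'"
  shows "\<chi> = \<chi>'"
  using cartesian_cancel[OF lift(2,1)[OF assms(1,2)] assms(3-5)] .

lemma lift_factor_vertical:
  assumes "\<phi> \<in> E u W X"
  obtains \<chi> where "\<chi> \<in> E (I (p W)) W (reindex_obj P u X)" "Lift P u X \<cdot> \<chi> = \<phi>"
proof -
  note u = overD(2)[OF assms]
  show ?thesis
    by (rule lift_factor[OF assms _ u base.Idn_hom])
      (use base.Idn_right[OF u] overD[OF assms] that in auto)
qed

lemma over_FArr: "t \<in> hom (Tot P) X Y \<Longrightarrow> t \<in> E (FArr (Prj P) t) X Y"
  by (simp add: hom_over_def)

end

section \<open>Coproducts\<close>

text \<open>The unit, turned from a vertical arrow into a reindexed object into an arrow over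
  \<open>u\<close>. By \<open>coprod_univ\<close> it is precocartesian.\<close>

definition coprod_inj ::
  "('bo, 'ba, 'eo, 'ea) fib \<Rightarrow> ('ba \<Rightarrow> ('eo, 'ea) adj) \<Rightarrow> 'ba \<Rightarrow> 'eo \<Rightarrow> 'ea" where
  "coprod_inj P \<Sigma> u \<beta> = Lift P u (FObj (Adj (\<Sigma> u)) \<beta>) \<odot>\<^bsub>Tot P\<^esub> Unit (\<Sigma> u) \<beta>"

locale fibration_with_quantifiers = cloven_fibration P + display_map_category "Bas P" \<F>
  for P :: "('bo, 'ba, 'eo, 'ea) fib" and \<F> :: "'ba set" +
  fixes \<Sigma> \<Pi> :: "'ba \<Rightarrow> ('eo, 'ea) adj"
  assumes coproducts: "is_coproducts P \<F> \<Sigma>"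
    and products: "is_products P \<F> \<Pi>"
begin

abbreviation Coprod where "Coprod u \<equiv> FObj (Adj (\<Sigma> u))"
abbreviation Prod where "Prod u \<equiv> FObj (Adj (\<Pi> u))"
abbreviation \<iota> where "\<iota> \<equiv> coprod_inj P \<Sigma>"

lemma coprod_adjunction:
  assumes "u \<in> \<F>" "u \<in> homB B A"
  shows "adjunction (fibre P B) (fibre P A) (Adj (\<Sigma> u)) (reindex P u) (Unit (\<Sigma> u)) (Counit (\<Sigma> u))"
    and "category (fibre P A)" "category (fibre P B)"
  using coproducts assms base.homD[OF assms(2)] fibre_category unfolding is_coproducts_def by auto

lemma coprod_unit:
  assumes "u \<in> \<F>" "\<beta> \<in> Obj (Tot P)" "u \<in> homB (p \<beta>) A"
  shows "Coprod u \<beta> \<in> Obj (Tot P)" "p (Coprod u \<beta>) = A"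
    and "Unit (\<Sigma> u) \<beta> \<in> E (I (p \<beta>)) \<beta> (reindex_obj P u (Coprod u \<beta>))"
    and "\<iota> u \<beta> \<in> E u \<beta> (Coprod u \<beta>)"
proof -
  note adj = adjunctionD[OF coprod_adjunction(1)[OF assms(1,3)]]
  show 1: "Coprod u \<beta> \<in> Obj (Tot P)" "p (Coprod u \<beta>) = A"
    using functorD(1)[OF adj(1), of \<beta>] assms(2) by auto
  show 2: "Unit (\<Sigma> u) \<beta> \<in> E (I (p \<beta>)) \<beta> (reindex_obj P u (Coprod u \<beta>))"
    using adj(3)[of \<beta>] assms(2) by (auto simp: hom_fibre)
  have "u \<in> homB (p \<beta>) (p (Coprod u \<beta>))" using assms(3) 1(2) by simp
  from vertical_comp_right[OF 2 lift(1)[OF 1(1) this]] base.homD(4)[OF assms(3)]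
  show "\<iota> u \<beta> \<in> E u \<beta> (Coprod u \<beta>)" by (simp add: coprod_inj_def)
qed

text \<open>The adjunction read in the total category: an arrow over \<open>u\<close> into
  \<open>Y\<close> amounts to its vertical factor through the lift of \<open>u\<close>, and that
  factor can be transposed.\<close>

lemma coprod_univ:
  assumes "u \<in> \<F>" "u \<in> homB (p \<beta>) A" "h \<in> E u \<beta> Y"
  shows "\<exists>!k. k \<in> E (I A) (Coprod u \<beta>) Y \<and> k \<cdot> \<iota> u \<beta> = h"
proof -
  note \<beta> = overD(4)[OF assms(3)] and Y = overD(5)[OF assms(3)]
  have B: "p \<beta> \<in> Obj (Bas P)" using base.homD[OF assms(2)] by simp
  have pY: "p Y = A" using over_base_eq[OF assms(3,2)] by simp
  note c = coprod_unit[OF assms(1) \<beta> assms(2)]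
  note adj = coprod_adjunction[OF assms(1,2)]
  have u: "u \<in> homB (p \<beta>) (p Y)" "u \<in> homB (p \<beta>) (p (Coprod u \<beta>))" using assms(2) pY c(2) by simp_all
  note L = lift(1)[OF Y u(1)] and LC = lift(1)[OF c(1) u(2)]
  \<comment> \<open>Precomposing with \<iota> means transposing and then composing with the lift of
    \<open>u\<close>. The lift can be cancelled, so bijectivity of transposition carries
    over.\<close>
  have inj: "k \<cdot> \<iota> u \<beta> = Lift P u Y \<cdot> (reindex_arr P u k \<cdot> Unit (\<Sigma> u) \<beta>)"
    if k: "k \<in> E (I A) (Coprod u \<beta>) Y" for k
    using assoc[OF c(3) LC k] assoc[OF c(3) reindex_arr(1)[OF k assms(2)] L]
    by (simp add: coprod_inj_def reindex_arr(2)[OF k assms(2)])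
  have tr: "reindex_arr P u k \<cdot> Unit (\<Sigma> u) \<beta> \<in> E (I (p \<beta>)) \<beta> (reindex_obj P u Y)"
    if k: "k \<in> E (I A) (Coprod u \<beta>) Y" for k
    using vertical_comp_left[OF c(3) reindex_arr(1)[OF k assms(2)] B] .
  obtain h1 where h1: "h1 \<in> E (I (p \<beta>)) \<beta> (reindex_obj P u Y)" "Lift P u Y \<cdot> h1 = h"
    using lift_factor_vertical[OF assms(3)] .
  show ?thesis
  proof (rule ex_ex1I)
    have "\<exists>k. k \<in> E (I A) (Coprod u \<beta>) Y \<and> reindex_arr P u k \<cdot> Unit (\<Sigma> u) \<beta> = h1"
      using adjunction_transpose[OF adj(3,2,1), of Y h1 \<beta>] h1(1) Y pY by (auto simp: hom_fibre)
    then show "\<exists>k. k \<in> E (I A) (Coprod u \<beta>) Y \<and> k \<cdot> \<iota> u \<beta> = h"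
      using inj h1(2) by auto
  next
    fix k k' assume k: "k \<in> E (I A) (Coprod u \<beta>) Y \<and> k \<cdot> \<iota> u \<beta> = h"
      and k': "k' \<in> E (I A) (Coprod u \<beta>) Y \<and> k' \<cdot> \<iota> u \<beta> = h"
    have "reindex_arr P u k \<cdot> Unit (\<Sigma> u) \<beta> = reindex_arr P u k' \<cdot> Unit (\<Sigma> u) \<beta>"
      by (rule lift_cancel[OF Y u(1) tr tr]) (use k k' inj in auto)
    then show "k = k'"
      using adjunction_cotranspose(2)[OF adj(3,2,1), of \<beta> k Y]
        adjunction_cotranspose(2)[OF adj(3,2,1), of \<beta> k' Y] k k' \<beta> by (auto simp: hom_fibre)
  qed
qed

lemma pullbackD:
  assumes "v \<in> \<F>" "is_pullback (Bas P) f v u g" "v \<in> homB L J"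
  obtains A K where "f \<in> homB A J" "u \<in> homB K A" "g \<in> homB K L" "u \<in> \<F>" "f \<star> u = v \<star> g"
    "\<forall>W. \<forall>a \<in> homB W A. \<forall>b \<in> homB W L. f \<star> a = v \<star> b \<longrightarrow>
      (\<exists>!w. w \<in> homB W K \<and> u \<star> w = a \<and> g \<star> w = b)"
proof -
  note pb = assms(2)[unfolded is_pullback_def]
  have L: "Dom (Bas P) v = L" "Cod (Bas P) v = J" using base.homD[OF assms(3)] by auto
  show ?thesis
    by (rule that[of "Dom (Bas P) f" "Dom (Bas P) u"])
      (use pb L pullback_stable[OF assms(1,2)] in \<open>auto simp: hom_def\<close>)
qed

text \<open>Up to the Beck--Chevalley isomorphism, \<open>\<Coprod>\<^sub>u g\<^sup>*\<beta> \<rightarrow> \<Coprod>\<^sub>v \<beta>\<close> is the cartesian lift of \<open>f\<close>.\<close>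

lemma coprod_base_change:
  assumes v: "v \<in> \<F>" "v \<in> homB (p \<beta>) J" and \<beta>: "\<beta> \<in> Obj (Tot P)"
    and pb: "is_pullback (Bas P) f v u g" "u \<in> \<F>"
    and f: "f \<in> homB A J" and u: "u \<in> homB K A" and g: "g \<in> homB K (p \<beta>)"
  obtains c where "c \<in> E f (Coprod u (reindex_obj P g \<beta>)) (Coprod v \<beta>)"
    "c \<cdot> \<iota> u (reindex_obj P g \<beta>) = \<iota> v \<beta> \<cdot> Lift P g \<beta>"
    "\<And>\<xi> \<phi>. \<phi> \<in> E f \<xi> (Coprod v \<beta>) \<Longrightarrow>
      \<exists>!\<chi>. \<chi> \<in> E (I A) \<xi> (Coprod u (reindex_obj P g \<beta>)) \<and> c \<cdot> \<chi> = \<phi>"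
proof -
  let ?Y = "Coprod v \<beta>" and ?g\<beta> = "reindex_obj P g \<beta>"
  have eq: "f \<star> u = v \<star> g" using pb by (simp add: is_pullback_def)
  have A: "A \<in> Obj (Bas P)" and K: "K \<in> Obj (Bas P)" and L: "p \<beta> \<in> Obj (Bas P)"
    using base.homD[OF u] base.homD[OF g] by auto
  note Y = coprod_unit[OF v(1) \<beta> v(2)]
  have fY: "f \<in> homB A (p ?Y)" and vY: "v \<in> homB (p \<beta>) (p ?Y)" using f v Y(2) by simp_all
  note g\<beta> = lift[OF \<beta> g]
  have ug: "u \<in> homB (p ?g\<beta>) A" using u g\<beta>(4) by simp
  note C = coprod_unit[OF pb(2) g\<beta>(3) ug]
  note sw = reindex_swap[OF Y(1) vY g fY u eq]
  note Lf = lift[OF Y(1) fY] and Lv = lift[OF Y(1) vY]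
  note Lu = lift[OF Lf(3), unfolded Lf(4), OF u] and Lg = lift[OF Lv(3), unfolded Lv(4), OF g]
  note \<eta>g = reindex_arr[OF Y(3) g]
  \<comment> \<open>\<open>s\<close> is the arrow whose transpose is the Beck--Chevalley map
    \<open>b\<close>. The required \<open>c\<close> will be \<open>Lift P f ?Y \<cdot> b\<close>: a
    cartesian lift preceded by a vertical isomorphism, so the factorization property
    survives.\<close>
  define s where "s = reindex_swap P v g f u ?Y \<cdot> reindex_arr P g (Unit (\<Sigma> v) \<beta>)"
  define b where "b = coprod_bc P \<Sigma> f v u g \<beta>"
  have s: "s \<in> E (I K) ?g\<beta> (reindex_obj P u (reindex_obj P f ?Y))"
    unfolding s_def by (rule vertical_comp_left[OF \<eta>g(1) sw(1) K])
  note adj = coprod_adjunction[OF pb(2) u]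
  have b: "b \<in> E (I A) (Coprod u ?g\<beta>) (reindex_obj P f ?Y)"
    and bs: "reindex_arr P u b \<cdot> Unit (\<Sigma> u) ?g\<beta> = s"
    using adjunction_transpose[OF adj(3,2,1), of "reindex_obj P f ?Y" s ?g\<beta>] s Lf(3,4)
    by (auto simp: hom_fibre b_def coprod_bc_def s_def Let_def)
  have \<beta>': "\<beta> \<in> Obj (fibre P (Dom (Bas P) v))" using \<beta> base.homD(2)[OF v(2)] by simp
  have "is_iso (fibre P (Dom (Bas P) f)) (coprod_bc P \<Sigma> f v u g \<beta>)"
    using coproducts v(1) pb \<beta>' unfolding is_coproducts_def by blast
  then have "is_iso (fibre P A) b" by (simp add: b_def base.homD(2)[OF f])
  from is_iso_fibreD[OF this b] obtain d where d: "d \<in> E (I A) (reindex_obj P f ?Y) (Coprod u ?g\<beta>)"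
    "d \<cdot> b = Idn (Tot P) (Coprod u ?g\<beta>)" "b \<cdot> d = Idn (Tot P) (reindex_obj P f ?Y)" .
  have uC: "u \<in> homB K (p (Coprod u ?g\<beta>))" using u C(2) by simp
  note LC = lift[OF C(1) uC]
  have \<eta>u: "Unit (\<Sigma> u) ?g\<beta> \<in> E (I K) ?g\<beta> (reindex_obj P u (Coprod u ?g\<beta>))" using C(3) g\<beta>(4) by simp
  note bu = reindex_arr[OF b u]
  have "(Lift P f ?Y \<cdot> b) \<cdot> \<iota> u ?g\<beta> = Lift P f ?Y \<cdot> (b \<cdot> (Lift P u (Coprod u ?g\<beta>) \<cdot> Unit (\<Sigma> u) ?g\<beta>))"
    using assoc[OF C(4) b Lf(1)] by (simp add: coprod_inj_def)
  also have "\<dots> = Lift P f ?Y \<cdot> (Lift P u (reindex_obj P f ?Y) \<cdot> s)"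
    using assoc[OF \<eta>u LC(1) b] assoc[OF \<eta>u bu(1) Lu(1)] by (simp add: bu(2) bs)
  also have "\<dots> = (Lift P f ?Y \<cdot> (Lift P u (reindex_obj P f ?Y) \<cdot> reindex_swap P v g f u ?Y))
        \<cdot> reindex_arr P g (Unit (\<Sigma> v) \<beta>)"
    using assoc[OF \<eta>g(1) vertical_comp_right[OF sw(1) Lu(1) K] Lf(1)] assoc[OF \<eta>g(1) sw(1) Lu(1)]
    by (simp add: s_def)
  also have "\<dots> = Lift P v ?Y \<cdot> (Unit (\<Sigma> v) \<beta> \<cdot> Lift P g \<beta>)"
    using assoc[OF \<eta>g(1) Lg(1) Lv(1)] by (simp add: sw(2) \<eta>g(2))
  also have "\<dots> = \<iota> v \<beta> \<cdot> Lift P g \<beta>"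
    using assoc[OF g\<beta>(1) Y(3) Lv(1)] by (simp add: coprod_inj_def)
  finally have 1: "(Lift P f ?Y \<cdot> b) \<cdot> \<iota> u ?g\<beta> = \<iota> v \<beta> \<cdot> Lift P g \<beta>" .
  have 2: "\<exists>!\<chi>. \<chi> \<in> E (I A) \<xi> (Coprod u ?g\<beta>) \<and> (Lift P f ?Y \<cdot> b) \<cdot> \<chi> = \<phi>"
    if \<phi>: "\<phi> \<in> E f \<xi> ?Y" for \<xi> \<phi>
  proof -
    obtain \<phi>0 where \<phi>0: "\<phi>0 \<in> E (I A) \<xi> (reindex_obj P f ?Y)" "Lift P f ?Y \<cdot> \<phi>0 = \<phi>"
      using lift_factor_vertical[OF \<phi>] over_base_eq[OF \<phi> f] by metis
    show ?thesis
    proof (rule ex_ex1I)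
      have "b \<cdot> (d \<cdot> \<phi>0) = \<phi>0" using assoc[OF \<phi>0(1) d(1) b] by (simp add: d(3) id_left[OF \<phi>0(1)])
      moreover have E: "d \<cdot> \<phi>0 \<in> E (I A) \<xi> (Coprod u ?g\<beta>)" by (rule vertical_comp_left[OF \<phi>0(1) d(1) A])
      ultimately show "\<exists>\<chi>. \<chi> \<in> E (I A) \<xi> (Coprod u ?g\<beta>) \<and> (Lift P f ?Y \<cdot> b) \<cdot> \<chi> = \<phi>"
        using assoc[OF E b Lf(1)] \<phi>0(2) by auto
    next
      fix \<chi> \<chi>' assume a: "\<chi> \<in> E (I A) \<xi> (Coprod u ?g\<beta>) \<and> (Lift P f ?Y \<cdot> b) \<cdot> \<chi> = \<phi>"
        "\<chi>' \<in> E (I A) \<xi> (Coprod u ?g\<beta>) \<and> (Lift P f ?Y \<cdot> b) \<cdot> \<chi>' = \<phi>"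
      then have c: "\<chi> \<in> E (I A) \<xi> (Coprod u ?g\<beta>)" "\<chi>' \<in> E (I A) \<xi> (Coprod u ?g\<beta>)" by auto
      have "b \<cdot> \<chi> = b \<cdot> \<chi>'"
        by (rule lift_cancel[OF Y(1) fY vertical_comp_left[OF c(1) b A] vertical_comp_left[OF c(2) b A]])
          (use a assoc[OF c(1) b Lf(1)] assoc[OF c(2) b Lf(1)] in simp)
      then have "(d \<cdot> b) \<cdot> \<chi> = (d \<cdot> b) \<cdot> \<chi>'" by (simp add: assoc[OF c(1) b d(1)] assoc[OF c(2) b d(1)])
      then show "\<chi> = \<chi>'" by (simp add: d(2) id_left[OF c(1)] id_left[OF c(2)])
    qed
  qed
  show ?thesis by (rule that[OF vertical_comp_right[OF b Lf(1) A] 1 2])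
qed

section \<open>Quantifier-free objects\<close>

text \<open>A section with a vertical arrow into the reindexed object is the same datum as one arrow
  \<open>t\<close> into \<beta>: the section is the projection of \<open>t\<close>, the vertical
  arrow is the factor of \<open>t\<close> through the lift of that section.\<close>

lemma splitting_factor_vertical:
  assumes qs: "quantifier_splitting P \<F> \<Sigma> A \<alpha>" and u: "u \<in> \<F>" "u \<in> homB (p \<beta>) A"
    and \<beta>: "\<beta> \<in> Obj (Tot P)" and h: "h \<in> E (I A) \<alpha> (Coprod u \<beta>)"
  shows "\<exists>!t. t \<in> hom (Tot P) \<alpha> \<beta> \<and> \<iota> u \<beta> \<cdot> t = h"
proof -
  let ?Y = "Coprod u \<beta>"
  note Y = coprod_unit[OF u(1) \<beta> u(2)]
  have A: "A \<in> Obj (Bas P)" and B: "p \<beta> \<in> Obj (Bas P)" using base.homD[OF u(2)] by auto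
  have uY: "u \<in> homB (p \<beta>) (p ?Y)" using u(2) Y(2) by simp
  note Lu = lift[OF Y(1) uY]
  let ?Q = "\<lambda>g h'. g \<in> homB A (p \<beta>) \<and> u \<star> g = I A \<and> h' \<in> E (I A) \<alpha> (reindex_obj P g \<beta>) \<and>
      h = reindex_section P u g ?Y \<cdot> reindex_arr P g (Unit (\<Sigma> u) \<beta>) \<cdot> h'"
  \<comment> \<open>The section isomorphism unfolds to two lifts, and the defining square of
    \<open>reindex_arr\<close> at the unit turns the prescribed composite into \<iota> after an
    arrow over \<open>g\<close>.\<close>
  have sec: "reindex_section P u g ?Y \<cdot> reindex_arr P g (Unit (\<Sigma> u) \<beta>) \<cdot> h' = \<iota> u \<beta> \<cdot> (Lift P g \<beta> \<cdot> h')"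
    if g: "g \<in> homB A (p \<beta>)" "u \<star> g = I A" and h': "h' \<in> E (I A) \<alpha> (reindex_obj P g \<beta>)" for g h'
  proof -
    note \<eta>g = reindex_arr[OF Y(3) g(1)] and Lg = lift[OF \<beta> g(1)]
    note LgY = lift[OF Lu(3), unfolded Lu(4), OF g(1)]
    have "reindex_section P u g ?Y = Lift P u ?Y \<cdot> Lift P g (reindex_obj P u ?Y)"
      using reindex_section[OF Y(1) uY] g Y(2) by simp
    then have "reindex_section P u g ?Y \<cdot> reindex_arr P g (Unit (\<Sigma> u) \<beta>) = \<iota> u \<beta> \<cdot> Lift P g \<beta>"
      using assoc[OF \<eta>g(1) LgY(1) Lu(1)] assoc[OF Lg(1) Y(3) Lu(1)] by (simp add: \<eta>g(2) coprod_inj_def)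
    then show ?thesis by (simp add: assoc[OF h' Lg(1) Y(4)])
  qed
  have "\<exists>!(g, h'). ?Q g h'"
    using qs u \<beta> h unfolding quantifier_splitting_def hom_fibre by auto
  then obtain g h' where Q: "?Q g h'" and Q': "\<forall>k k'. ?Q k k' \<longrightarrow> k = g \<and> k' = h'"
    by (rule ex1_pairE)
  have t: "Lift P g \<beta> \<cdot> h' \<in> hom (Tot P) \<alpha> \<beta>"
    using overD(1)[OF over_comp[OF _ lift(1)[OF \<beta>]]] Q by blast
  show ?thesis
  proof (rule ex1I)
    show "Lift P g \<beta> \<cdot> h' \<in> hom (Tot P) \<alpha> \<beta> \<and> \<iota> u \<beta> \<cdot> (Lift P g \<beta> \<cdot> h') = h"
      using t sec Q by simp
    fix t assume t: "t \<in> hom (Tot P) \<alpha> \<beta> \<and> \<iota> u \<beta> \<cdot> t = h"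
    define k where "k = FArr (Prj P) t"
    have tk: "t \<in> E k \<alpha> \<beta>" using t over_FArr k_def by simp
    have p\<alpha>: "p \<alpha> = A" using vertical_base[OF h A] by simp
    then have k: "k \<in> homB A (p \<beta>)" using overD(2)[OF tk] by simp
    have uk: "u \<star> k = I A" using overD(3)[OF over_comp[OF tk Y(4)]] overD(3)[OF h] t by simp
    obtain k' where k': "k' \<in> E (I A) \<alpha> (reindex_obj P k \<beta>)" "Lift P k \<beta> \<cdot> k' = t"
      using lift_factor_vertical[OF tk] p\<alpha> by metis
    have "?Q k k'" using k uk k' sec[OF k uk k'(1)] t by simp
    then show "t = Lift P g \<beta> \<cdot> h'" using Q' k'(2) by blast
  qed
qed

text \<open>Pulling \<open>v\<close> back along \<open>r\<close> makes the problem vertical: by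
  \<open>coprod_base_change\<close>, \<phi> corresponds to a vertical arrow into the coproduct along
  the pulled back map, where the previous lemma applies. The lift of \<open>g\<close> leads back to
  \<beta>.\<close>

lemma splitting_factor:
  assumes qs: "quantifier_splitting P \<F> \<Sigma> A \<xi>" and v: "v \<in> \<F>" "v \<in> homB (p \<beta>) J"
    and \<beta>: "\<beta> \<in> Obj (Tot P)" and \<phi>: "\<phi> \<in> E r \<xi> (Coprod v \<beta>)"
  shows "\<exists>!t. t \<in> hom (Tot P) \<xi> \<beta> \<and> \<iota> v \<beta> \<cdot> t = \<phi>"
proof -
  note Y = coprod_unit[OF v(1) \<beta> v(2)]
  have p\<xi>: "p \<xi> = A" using qs by (simp add: quantifier_splitting_def)
  have r: "r \<in> homB A J" using overD(2)[OF \<phi>] p\<xi> Y(2) by simp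
  have A: "A \<in> Obj (Bas P)" using base.homD[OF r] by simp
  obtain u g where pb: "is_pullback (Bas P) r v u g"
    using pullback_exists[OF v(1), of r] base.homD[OF r] base.homD[OF v(2)] by auto
  obtain A' K where K: "r \<in> homB A' J" "u \<in> homB K A'" "g \<in> homB K (p \<beta>)" "u \<in> \<F>" "r \<star> u = v \<star> g"
    and univ: "\<forall>W. \<forall>a \<in> homB W A'. \<forall>b \<in> homB W (p \<beta>). r \<star> a = v \<star> b \<longrightarrow>
      (\<exists>!w. w \<in> homB W K \<and> u \<star> w = a \<and> g \<star> w = b)"
    using pullbackD[OF v(1) pb v(2)] .
  have [simp]: "A' = A" using K(1) r by (simp add: hom_def)
  note u = K(2)[simplified]
  obtain c where c: "c \<in> E r (Coprod u (reindex_obj P g \<beta>)) (Coprod v \<beta>)"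
    "c \<cdot> \<iota> u (reindex_obj P g \<beta>) = \<iota> v \<beta> \<cdot> Lift P g \<beta>"
    "\<And>\<xi> \<phi>. \<phi> \<in> E r \<xi> (Coprod v \<beta>) \<Longrightarrow>
      \<exists>!\<chi>. \<chi> \<in> E (I A) \<xi> (Coprod u (reindex_obj P g \<beta>)) \<and> c \<cdot> \<chi> = \<phi>"
    using coprod_base_change[OF v \<beta> pb K(4) r u K(3)] by metis
  note Lg = lift[OF \<beta> K(3)]
  have ug: "u \<in> homB (p (reindex_obj P g \<beta>)) A" using u Lg(4) by simp
  note C = coprod_unit[OF K(4) Lg(3) ug]
  obtain \<phi>1 where \<phi>1: "\<phi>1 \<in> E (I A) \<xi> (Coprod u (reindex_obj P g \<beta>))" "c \<cdot> \<phi>1 = \<phi>"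
    using c(3)[OF \<phi>] by blast
  have ex1: "\<exists>!t. t \<in> hom (Tot P) \<xi> (reindex_obj P g \<beta>) \<and> \<iota> u (reindex_obj P g \<beta>) \<cdot> t = \<phi>1"
    by (rule splitting_factor_vertical[OF qs K(4) ug Lg(3) \<phi>1(1)])
  then obtain t1 where t1: "t1 \<in> hom (Tot P) \<xi> (reindex_obj P g \<beta>)" "\<iota> u (reindex_obj P g \<beta>) \<cdot> t1 = \<phi>1"
    by blast
  have inj: "\<iota> v \<beta> \<cdot> (Lift P g \<beta> \<cdot> t) = c \<cdot> (\<iota> u (reindex_obj P g \<beta>) \<cdot> t)"
    if t: "t \<in> hom (Tot P) \<xi> (reindex_obj P g \<beta>)" for t
    using assoc[OF over_FArr[OF t] Lg(1) Y(4)] assoc[OF over_FArr[OF t] C(4) c(1)] c(2) by simp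
  show ?thesis
  proof (rule ex1I)
    show "Lift P g \<beta> \<cdot> t1 \<in> hom (Tot P) \<xi> \<beta> \<and> \<iota> v \<beta> \<cdot> (Lift P g \<beta> \<cdot> t1) = \<phi>"
      using inj[OF t1(1)] t1(2) \<phi>1(2) overD(1)[OF over_comp[OF over_FArr[OF t1(1)] Lg(1)]] by simp
    fix t assume t: "t \<in> hom (Tot P) \<xi> \<beta> \<and> \<iota> v \<beta> \<cdot> t = \<phi>"
    define s where "s = FArr (Prj P) t"
    have ts: "t \<in> E s \<xi> \<beta>" using t over_FArr s_def by simp
    have s: "s \<in> homB A (p \<beta>)" using overD(2)[OF ts] p\<xi> by simp
    have "v \<star> s = r" using overD(3)[OF over_comp[OF ts Y(4)]] overD(3)[OF \<phi>] t by simp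
    \<comment> \<open>A competing \<open>t\<close> lies over some \<open>s\<close> with
      \<open>v \<star> s = r\<close>. Together with the identity of \<open>A\<close> this is a cone
      over the pullback, so \<open>s\<close> is \<open>g \<star> m\<close> for a section
      \<open>m\<close> of \<open>u\<close>, and \<open>t\<close> factors through the lift of
      \<open>g\<close>.\<close>
    then obtain m where m: "m \<in> homB A K" "u \<star> m = I A" "g \<star> m = s"
      using univ[rule_format, of "I A" A s] s base.Idn_hom[OF A] base.Idn_right[OF r] by auto
    obtain t' where t': "t' \<in> E m \<xi> (reindex_obj P g \<beta>)" "Lift P g \<beta> \<cdot> t' = t"
      using lift_factor[OF ts _ K(3), of m] m p\<xi> by metis
    have "\<iota> u (reindex_obj P g \<beta>) \<cdot> t' \<in> E (I A) \<xi> (Coprod u (reindex_obj P g \<beta>))"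
      by (rule over_comp'[OF t'(1) C(4) m(2)])
    moreover have "c \<cdot> (\<iota> u (reindex_obj P g \<beta>) \<cdot> t') = \<phi>"
      using inj[OF overD(1)[OF t'(1)]] t'(2) t by simp
    ultimately have "\<iota> u (reindex_obj P g \<beta>) \<cdot> t' = \<phi>1" using c(3)[OF \<phi>] \<phi>1 by blast
    then have "t' = t1" using ex1 t1 overD(1)[OF t'(1)] by blast
    then show "t = Lift P g \<beta> \<cdot> t1" using t'(2) by simp
  qed
qed

text \<open>Quantifier-freeness speaks of reindexings of \<delta>, not of \<delta> itself. The
  reindexing along the identity is splitting, and its lift \<open>?l\<close> with the section
  \<open>m\<close> transfers the unique factorization to \<delta>.\<close>

lemma quantifier_free_factor:
  assumes qf: "quantifier_free P \<F> \<Sigma> A \<delta>" and v: "v \<in> \<F>" "v \<in> homB (p \<beta>) J"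
    and \<beta>: "\<beta> \<in> Obj (Tot P)" and \<phi>: "\<phi> \<in> E r \<delta> (Coprod v \<beta>)"
  shows "\<exists>!t. t \<in> hom (Tot P) \<delta> \<beta> \<and> \<iota> v \<beta> \<cdot> t = \<phi>"
proof -
  have \<delta>: "\<delta> \<in> Obj (Tot P)" "p \<delta> = A" using qf by (auto simp: quantifier_free_def)
  have A: "A \<in> Obj (Bas P)" using proj(1)[OF \<delta>(1)] \<delta>(2) by simp
  note idA = base.Idn_hom[OF A]
  let ?\<delta> = "reindex_obj P (I A) \<delta>" and ?l = "Lift P (I A) \<delta>"
  have qs: "quantifier_splitting P \<F> \<Sigma> A ?\<delta>" using qf idA by (auto simp: quantifier_free_def)
  note Y = coprod_unit[OF v(1) \<beta> v(2)]
  note l = lift[OF \<delta>(1), unfolded \<delta>(2), OF idA]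
  obtain m where m: "m \<in> E (I A) \<delta> ?\<delta>" "?l \<cdot> m = Idn (Tot P) \<delta>"
    using lift_factor_vertical[OF over_id[OF \<delta>]] \<delta>(2) by metis
  have lm: "t \<cdot> ?l \<cdot> m = t" if "t \<in> hom (Tot P) \<delta> Z" for t Z
    using assoc[OF m(1) l(1) over_FArr[OF that]] m(2) id_right[OF over_FArr[OF that]] by simp
  have ex1: "\<exists>!t. t \<in> hom (Tot P) ?\<delta> \<beta> \<and> \<iota> v \<beta> \<cdot> t = \<phi> \<cdot> ?l"
    by (rule splitting_factor[OF qs v \<beta> over_comp[OF l(1) \<phi>]])
  then obtain t where t: "t \<in> hom (Tot P) ?\<delta> \<beta>" "\<iota> v \<beta> \<cdot> t = \<phi> \<cdot> ?l" by blast
  show ?thesis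
  proof (rule ex1I)
    have "\<iota> v \<beta> \<cdot> (t \<cdot> m) = \<phi>"
      using assoc[OF m(1) over_FArr[OF t(1)] Y(4)] lm[OF overD(1)[OF \<phi>]] t(2) by simp
    then show "t \<cdot> m \<in> hom (Tot P) \<delta> \<beta> \<and> \<iota> v \<beta> \<cdot> (t \<cdot> m) = \<phi>"
      using overD(1)[OF over_comp[OF m(1) over_FArr[OF t(1)]]] by simp
    fix t' assume t': "t' \<in> hom (Tot P) \<delta> \<beta> \<and> \<iota> v \<beta> \<cdot> t' = \<phi>"
    then have E: "t' \<in> E (FArr (Prj P) t') \<delta> \<beta>" by (simp add: over_FArr)
    have "t' \<cdot> ?l = t"
      using ex1 t overD(1)[OF over_comp[OF l(1) E]] assoc[OF l(1) E Y(4)] t' by auto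
    then show "t' = t \<cdot> m" using lm[of t' \<beta>] t' by auto
  qed
qed

section \<open>Products\<close>

text \<open>For a square \<open>fu = vg\<close>, an arrow \<open>\<phi> : \<gamma> \<rightarrow> \<Prod>\<^sub>v \<beta>\<close> over \<open>f\<close> induces \<open>u\<^sup>*\<gamma> \<rightarrow> v\<^sup>*\<Prod>\<^sub>v \<beta>\<close> over
  \<open>g\<close>; its composite with the counit is the transpose \<open>\<zeta> : u\<^sup>*\<gamma> \<rightarrow> \<beta>\<close> of \<open>\<phi>\<close>.\<close>

definition is_transpose :: "'ba \<Rightarrow> 'ba \<Rightarrow> 'ba \<Rightarrow> 'eo \<Rightarrow> 'eo \<Rightarrow> 'ea \<Rightarrow> 'ea \<Rightarrow> bool" where
  "is_transpose v u g \<gamma> \<beta> \<phi> \<zeta> \<longleftrightarrow>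
     (\<exists>\<psi> \<in> E g (reindex_obj P u \<gamma>) (reindex_obj P v (Prod v \<beta>)).
        Lift P v (Prod v \<beta>) \<cdot> \<psi> = \<phi> \<cdot> Lift P u \<gamma> \<and> Counit (\<Pi> v) \<beta> \<cdot> \<psi> = \<zeta>)"

lemma prod_adjunction:
  assumes "u \<in> \<F>" "u \<in> homB B A"
  shows "adjunction (fibre P A) (fibre P B) (reindex P u) (Adj (\<Pi> u)) (Unit (\<Pi> u)) (Counit (\<Pi> u))"
    and "category (fibre P A)" "category (fibre P B)"
  using products assms base.homD[OF assms(2)] fibre_category unfolding is_products_def by auto

lemma prod_counit:
  assumes "u \<in> \<F>" "\<beta> \<in> Obj (Tot P)" "u \<in> homB (p \<beta>) A"
  shows "Prod u \<beta> \<in> Obj (Tot P)" "p (Prod u \<beta>) = A"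
    and "Counit (\<Pi> u) \<beta> \<in> E (I (p \<beta>)) (reindex_obj P u (Prod u \<beta>)) \<beta>"
proof -
  note adj = adjunctionD[OF prod_adjunction(1)[OF assms(1,3)]]
  show "Prod u \<beta> \<in> Obj (Tot P)" "p (Prod u \<beta>) = A"
    using functorD(1)[OF adj(2), of \<beta>] assms(2) by auto
  show "Counit (\<Pi> u) \<beta> \<in> E (I (p \<beta>)) (reindex_obj P u (Prod u \<beta>)) \<beta>"
    using adj(4)[of \<beta>] assms(2) by (auto simp: hom_fibre)
qed

text \<open>The middle arrow \<psi> of the transpose is the unique one that
  \<open>base_change\<close> supplies for the commuting square; the counit then determines
  \<zeta>.\<close>

lemma transpose_exists:
  assumes v: "v \<in> \<F>" "v \<in> homB (p \<beta>) J" and \<beta>: "\<beta> \<in> Obj (Tot P)"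
    and \<phi>: "\<phi> \<in> E f \<gamma> (Prod v \<beta>)" and u: "u \<in> homB K (p \<gamma>)" and g: "g \<in> homB K (p \<beta>)"
    and eq: "f \<star> u = v \<star> g"
  shows "\<exists>!\<zeta>. is_transpose v u g \<gamma> \<beta> \<phi> \<zeta>"
    and "is_transpose v u g \<gamma> \<beta> \<phi> \<zeta> \<Longrightarrow> \<zeta> \<in> E g (reindex_obj P u \<gamma>) \<beta>"
proof -
  note Y = prod_counit[OF v(1) \<beta> v(2)]
  have L: "p \<beta> \<in> Obj (Bas P)" using base.homD[OF g] by simp
  have "v \<in> homB (p \<beta>) (p (Prod v \<beta>))" using v(2) Y(2) by simp
  from base_change[OF \<phi> u this g eq] show "\<exists>!\<zeta>. is_transpose v u g \<gamma> \<beta> \<phi> \<zeta>"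
    unfolding is_transpose_def by blast
  show "is_transpose v u g \<gamma> \<beta> \<phi> \<zeta> \<Longrightarrow> \<zeta> \<in> E g (reindex_obj P u \<gamma>) \<beta>"
    unfolding is_transpose_def using vertical_comp_left[OF _ Y(3) L] by blast
qed

text \<open>For a pullback square transposition is invertible. Arrows into the product over
  \<open>f\<close> factor vertically through the lift of \<open>f\<close>; Beck--Chevalley replaces
  the target by a product along \<open>u\<close>; the adjunction gives an arrow out of the
  reindexing of \<gamma>; the lift of \<open>g\<close> ends at \<beta>.\<close>

lemma prod_base_change:
  assumes v: "v \<in> \<F>" "v \<in> homB (p \<beta>) J" and \<beta>: "\<beta> \<in> Obj (Tot P)"
    and pb: "is_pullback (Bas P) f v u g" "u \<in> \<F>"
    and f: "f \<in> homB (p \<gamma>) J" and u: "u \<in> homB K (p \<gamma>)" and g: "g \<in> homB K (p \<beta>)"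
    and \<gamma>: "\<gamma> \<in> Obj (Tot P)" and \<zeta>: "\<zeta> \<in> E g (reindex_obj P u \<gamma>) \<beta>"
  shows "\<exists>!\<phi>. \<phi> \<in> E f \<gamma> (Prod v \<beta>) \<and> is_transpose v u g \<gamma> \<beta> \<phi> \<zeta>"
proof -
  let ?Y = "Prod v \<beta>" and ?g\<beta> = "reindex_obj P g \<beta>" and ?A = "p \<gamma>"
  have eq: "f \<star> u = v \<star> g" using pb by (simp add: is_pullback_def)
  have A: "?A \<in> Obj (Bas P)" and K: "K \<in> Obj (Bas P)" and L: "p \<beta> \<in> Obj (Bas P)"
    using base.homD[OF u] base.homD[OF g] by auto
  note Y = prod_counit[OF v(1) \<beta> v(2)]
  have fY: "f \<in> homB ?A (p ?Y)" and vY: "v \<in> homB (p \<beta>) (p ?Y)" using f v Y(2) by simp_all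
  note Lg\<beta> = lift[OF \<beta> g] and Lu\<gamma> = lift[OF \<gamma> u]
  have ug: "u \<in> homB (p ?g\<beta>) ?A" using u Lg\<beta>(4) by simp
  note C = prod_counit[OF pb(2) Lg\<beta>(3) ug]
  note sw = reindex_swap[OF Y(1) fY u vY g eq[symmetric]]
  note Lf = lift[OF Y(1) fY] and Lv = lift[OF Y(1) vY]
  note Lu = lift[OF Lf(3), unfolded Lf(4), OF u] and Lg = lift[OF Lv(3), unfolded Lv(4), OF g]
  note \<epsilon>g = reindex_arr[OF Y(3) g]
  have \<epsilon>u: "Counit (\<Pi> u) ?g\<beta> \<in> E (I K) (reindex_obj P u (Prod u ?g\<beta>)) ?g\<beta>" using C(3) Lg\<beta>(4) by simp
  define s where "s = reindex_arr P g (Counit (\<Pi> v) \<beta>) \<cdot> reindex_swap P f u v g ?Y"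
  define b where "b = prod_bc P \<Pi> f v u g \<beta>"
  have s: "s \<in> E (I K) (reindex_obj P u (reindex_obj P f ?Y)) ?g\<beta>"
    unfolding s_def by (rule vertical_comp_left[OF sw(1) \<epsilon>g(1) K])
  note adj = prod_adjunction[OF pb(2) u]
  have b: "b \<in> E (I ?A) (reindex_obj P f ?Y) (Prod u ?g\<beta>)"
    and bs: "Counit (\<Pi> u) ?g\<beta> \<cdot> reindex_arr P u b = s"
    using adjunction_cotranspose[OF adj(2,3,1), of "reindex_obj P f ?Y" s ?g\<beta>] s Lf(3,4)
    by (auto simp: hom_fibre b_def prod_bc_def s_def Let_def)
  have \<beta>': "\<beta> \<in> Obj (fibre P (Dom (Bas P) v))" using \<beta> base.homD(2)[OF v(2)] by simp
  have "is_iso (fibre P (Dom (Bas P) f)) (prod_bc P \<Pi> f v u g \<beta>)"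
    using products v(1) pb \<beta>' unfolding is_products_def by blast
  then have "is_iso (fibre P ?A) b" by (simp add: b_def base.homD(2)[OF f])
  from is_iso_fibreD[OF this b] obtain d where d: "d \<in> E (I ?A) (Prod u ?g\<beta>) (reindex_obj P f ?Y)"
    "d \<cdot> b = Idn (Tot P) (reindex_obj P f ?Y)" "b \<cdot> d = Idn (Tot P) (Prod u ?g\<beta>)" .
  note bu = reindex_arr[OF b u]
  \<comment> \<open>The transpose of \<open>Lift P f ?Y \<cdot> \<chi>\<close> is the adjoint
    transpose of \<open>b \<cdot> \<chi>\<close> followed by the lift of \<open>g\<close>. As
    \<open>b\<close> is invertible, existence and uniqueness both reduce to the adjunction for
    \<open>u\<close>.\<close>
  have transpose: "is_transpose v u g \<gamma> \<beta> (Lift P f ?Y \<cdot> \<chi>)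
      (Lift P g \<beta> \<cdot> (Counit (\<Pi> u) ?g\<beta> \<cdot> reindex_arr P u (b \<cdot> \<chi>)))"
    if \<chi>: "\<chi> \<in> E (I ?A) \<gamma> (reindex_obj P f ?Y)" for \<chi>
  proof -
    let ?\<psi> = "Lift P g (reindex_obj P v ?Y) \<cdot> (reindex_swap P f u v g ?Y \<cdot> reindex_arr P u \<chi>)"
    note \<chi>u = reindex_arr[OF \<chi> u]
    have s\<chi>: "reindex_swap P f u v g ?Y \<cdot> reindex_arr P u \<chi>
        \<in> E (I K) (reindex_obj P u \<gamma>) (reindex_obj P g (reindex_obj P v ?Y))"
      by (rule vertical_comp_left[OF \<chi>u(1) sw(1) K])
    have \<psi>: "?\<psi> \<in> E g (reindex_obj P u \<gamma>) (reindex_obj P v ?Y)"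
      by (rule vertical_comp_right[OF s\<chi> Lg(1) K])
    have "Lift P v ?Y \<cdot> ?\<psi> = (Lift P v ?Y \<cdot> (Lift P g (reindex_obj P v ?Y) \<cdot> reindex_swap P f u v g ?Y))
        \<cdot> reindex_arr P u \<chi>"
      using assoc[OF \<chi>u(1) sw(1) Lg(1)] assoc[OF \<chi>u(1) vertical_comp_right[OF sw(1) Lg(1) K] Lv(1)] by simp
    also have "\<dots> = Lift P f ?Y \<cdot> (\<chi> \<cdot> Lift P u \<gamma>)"
      by (simp add: sw(2) assoc[OF \<chi>u(1) Lu(1) Lf(1)] \<chi>u(2))
    also have "\<dots> = (Lift P f ?Y \<cdot> \<chi>) \<cdot> Lift P u \<gamma>" by (simp add: assoc[OF Lu\<gamma>(1) \<chi> Lf(1)])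
    finally have 1: "Lift P v ?Y \<cdot> ?\<psi> = (Lift P f ?Y \<cdot> \<chi>) \<cdot> Lift P u \<gamma>" .
    have "reindex_arr P u (b \<cdot> \<chi>) = reindex_arr P u b \<cdot> reindex_arr P u \<chi>"
      using functorD(4)[OF adjunctionD(1)[OF adj(1)]] \<chi> b by (auto simp: hom_fibre)
    then have "Lift P g \<beta> \<cdot> (Counit (\<Pi> u) ?g\<beta> \<cdot> reindex_arr P u (b \<cdot> \<chi>)) = Lift P g \<beta> \<cdot> (s \<cdot> reindex_arr P u \<chi>)"
      by (simp add: assoc[OF \<chi>u(1) bu(1) \<epsilon>u, symmetric] bs)
    also have "\<dots> = (Lift P g \<beta> \<cdot> reindex_arr P g (Counit (\<Pi> v) \<beta>)) \<cdot> (reindex_swap P f u v g ?Y \<cdot> reindex_arr P u \<chi>)"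
      using assoc[OF s\<chi> \<epsilon>g(1) Lg\<beta>(1)] assoc[OF \<chi>u(1) sw(1) \<epsilon>g(1)] by (simp add: s_def)
    also have "\<dots> = Counit (\<Pi> v) \<beta> \<cdot> ?\<psi>"
      by (simp add: \<epsilon>g(2) assoc[OF s\<chi> Lg(1) Y(3)])
    finally show ?thesis using \<psi> 1 unfolding is_transpose_def by auto
  qed
  obtain \<zeta>1 where \<zeta>1: "\<zeta>1 \<in> E (I K) (reindex_obj P u \<gamma>) ?g\<beta>" "Lift P g \<beta> \<cdot> \<zeta>1 = \<zeta>"
    using lift_factor_vertical[OF \<zeta>] Lu\<gamma>(4) by metis
  show ?thesis
  proof (rule ex_ex1I)
    obtain a where a: "a \<in> E (I ?A) \<gamma> (Prod u ?g\<beta>)" "Counit (\<Pi> u) ?g\<beta> \<cdot> reindex_arr P u a = \<zeta>1"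
      using adjunction_cotranspose[OF adj(2,3,1), of \<gamma> \<zeta>1 ?g\<beta>] \<zeta>1(1) \<gamma> by (auto simp: hom_fibre)
    have da: "d \<cdot> a \<in> E (I ?A) \<gamma> (reindex_obj P f ?Y)" by (rule vertical_comp_left[OF a(1) d(1) A])
    have "b \<cdot> (d \<cdot> a) = a" using assoc[OF a(1) d(1) b] by (simp add: d(3) id_left[OF a(1)])
    then have "is_transpose v u g \<gamma> \<beta> (Lift P f ?Y \<cdot> (d \<cdot> a)) \<zeta>" using transpose[OF da] a(2) \<zeta>1(2) by simp
    moreover have "Lift P f ?Y \<cdot> (d \<cdot> a) \<in> E f \<gamma> ?Y" by (rule vertical_comp_right[OF da Lf(1) A])
    ultimately show "\<exists>\<phi>. \<phi> \<in> E f \<gamma> ?Y \<and> is_transpose v u g \<gamma> \<beta> \<phi> \<zeta>" by blast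
  next
    have determined: "\<exists>\<chi>. \<chi> \<in> E (I ?A) \<gamma> (reindex_obj P f ?Y) \<and> Lift P f ?Y \<cdot> \<chi> = \<phi> \<and>
        \<chi> = d \<cdot> (FArr (Adj (\<Pi> u)) \<zeta>1 \<cdot> Unit (\<Pi> u) \<gamma>)"
      if \<phi>: "\<phi> \<in> E f \<gamma> ?Y" "is_transpose v u g \<gamma> \<beta> \<phi> \<zeta>" for \<phi>
    proof -
      obtain \<chi> where \<chi>: "\<chi> \<in> E (I ?A) \<gamma> (reindex_obj P f ?Y)" "Lift P f ?Y \<cdot> \<chi> = \<phi>"
        using lift_factor_vertical[OF \<phi>(1)] .
      have b\<chi>: "b \<cdot> \<chi> \<in> E (I ?A) \<gamma> (Prod u ?g\<beta>)" by (rule vertical_comp_left[OF \<chi>(1) b A])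
      have "\<zeta> = Lift P g \<beta> \<cdot> (Counit (\<Pi> u) ?g\<beta> \<cdot> reindex_arr P u (b \<cdot> \<chi>))"
        using transpose[OF \<chi>(1)] \<phi>(2) transpose_exists(1)[OF v \<beta> \<phi>(1) u g eq] \<chi>(2) by auto
      then have "\<zeta>1 = Counit (\<Pi> u) ?g\<beta> \<cdot> reindex_arr P u (b \<cdot> \<chi>)"
        using lift_cancel[OF \<beta> g \<zeta>1(1) vertical_comp_left[OF reindex_arr(1)[OF b\<chi> u] \<epsilon>u K]] \<zeta>1(2) by simp
      then have "FArr (Adj (\<Pi> u)) \<zeta>1 \<cdot> Unit (\<Pi> u) \<gamma> = b \<cdot> \<chi>"
        using adjunction_transpose(2)[OF adj(2,3,1), of ?g\<beta> "b \<cdot> \<chi>" \<gamma>] b\<chi> Lg\<beta>(3,4) by (auto simp: hom_fibre)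
      then have "d \<cdot> (FArr (Adj (\<Pi> u)) \<zeta>1 \<cdot> Unit (\<Pi> u) \<gamma>) = \<chi>"
        using assoc[OF \<chi>(1) b d(1)] by (simp add: d(2) id_left[OF \<chi>(1)])
      with \<chi> show ?thesis by auto
    qed
    fix \<phi> \<phi>' assume "\<phi> \<in> E f \<gamma> ?Y \<and> is_transpose v u g \<gamma> \<beta> \<phi> \<zeta>" "\<phi>' \<in> E f \<gamma> ?Y \<and> is_transpose v u g \<gamma> \<beta> \<phi>' \<zeta>"
    then show "\<phi> = \<phi>'" using determined by metis
  qed
qed

section \<open>Recognizing vertical isomorphisms by postcomposition\<close>

lemma isomorphic_if_postcomp_bij:
  assumes \<Phi>: "\<Phi> \<in> E (I A) X Y" and A: "A \<in> Obj (Bas P)"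
    and bij: "\<And>Z \<psi>. \<psi> \<in> E (I A) Z Y \<Longrightarrow> \<exists>!\<chi>. \<chi> \<in> E (I A) Z X \<and> \<Phi> \<cdot> \<chi> = \<psi>"
  shows "isomorphic (fibre P A) Y X"
proof -
  note pXY = vertical_base[OF \<Phi> A]
  have idX: "Idn (Tot P) X \<in> E (I A) X X" and idY: "Idn (Tot P) Y \<in> E (I A) Y Y"
    using over_id overD(4,5)[OF \<Phi>] pXY by auto
  \<comment> \<open>The Yoneda argument in the fibre: the preimage of the identity of
    \<open>Y\<close> is a right inverse of \<Phi>, and injectivity of postcomposition makes it a
    left inverse.\<close>
  obtain \<Psi> where \<Psi>: "\<Psi> \<in> E (I A) Y X" "\<Phi> \<cdot> \<Psi> = Idn (Tot P) Y" using bij[OF idY] by blast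
  have "\<Phi> \<cdot> (\<Psi> \<cdot> \<Phi>) = \<Phi>" using assoc[OF \<Phi> \<Psi>(1) \<Phi>] by (simp add: \<Psi>(2) id_left[OF \<Phi>])
  then have "\<Psi> \<cdot> \<Phi> = Idn (Tot P) X"
    using bij[OF \<Phi>] idX id_right[OF \<Phi>] vertical_comp_left[OF \<Phi> \<Psi>(1) A] by blast
  then show ?thesis
    using inverse_arrows_fibreI[OF \<Psi>(1) \<Phi> \<Psi>(2)] \<Psi>(1)
    unfolding isomorphic_def is_iso_def hom_fibre by blast
qed

text \<open>Every object is some \<open>\<Coprod>\<^sub>k \<delta>\<close> with \<open>\<delta>\<close> quantifier-free, so such objects suffice as test objects.\<close>

lemma isomorphic_if_postcomp_bij_quantifier_free:
  assumes enough: "enough_quantifier_free P \<F> \<Sigma>"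
    and \<Phi>: "\<Phi> \<in> E (I A) X Y" and A: "A \<in> Obj (Bas P)"
    and bij: "\<And>D k \<delta> \<psi>. k \<in> \<F> \<Longrightarrow> k \<in> homB D A \<Longrightarrow> quantifier_free P \<F> \<Sigma> D \<delta> \<Longrightarrow>
      \<psi> \<in> E k \<delta> Y \<Longrightarrow> \<exists>!\<chi>. \<chi> \<in> E k \<delta> X \<and> \<Phi> \<cdot> \<chi> = \<psi>"
  shows "isomorphic (fibre P A) Y X"
proof (rule isomorphic_if_postcomp_bij[OF \<Phi> A])
  fix Z \<psi> assume \<psi>: "\<psi> \<in> E (I A) Z Y"
  have "Z \<in> Obj (fibre P A)" using overD(4)[OF \<psi>] vertical_base[OF \<psi> A] by simp
  then obtain D k \<delta> where k: "k \<in> \<F>" "k \<in> homB D A" and qf: "quantifier_free P \<F> \<Sigma> D \<delta>"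
    and iso: "isomorphic (fibre P A) Z (Coprod k \<delta>)"
    using enough A unfolding enough_quantifier_free_def by meson
  obtain i where i: "i \<in> E (I A) Z (Coprod k \<delta>)" "is_iso (fibre P A) i"
    using iso by (auto simp: isomorphic_def hom_fibre)
  from is_iso_fibreD[OF i(2,1)] obtain j where j: "j \<in> E (I A) (Coprod k \<delta>) Z"
    "j \<cdot> i = Idn (Tot P) Z" "i \<cdot> j = Idn (Tot P) (Coprod k \<delta>)" .
  have \<delta>: "\<delta> \<in> Obj (Tot P)" "p \<delta> = D" using qf by (auto simp: quantifier_free_def)
  have k': "k \<in> homB (p \<delta>) A" using k \<delta> by simp
  note \<iota> = coprod_unit(4)[OF k(1) \<delta>(1) k']
  note univ = coprod_univ[OF k(1) k']
  have \<psi>j: "\<psi> \<cdot> j \<in> E (I A) (Coprod k \<delta>) Y" by (rule vertical_comp_left[OF j(1) \<psi> A])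
  \<comment> \<open>The assumed bijection concerns arrows out of \<delta> over \<open>k\<close>;
    precomposing with \<open>j\<close> and the injection of \<delta> translates vertical arrows out
    of \<open>Z\<close> into such arrows.\<close>
  have ex1: "\<exists>!\<chi>. \<chi> \<in> E k \<delta> X \<and> \<Phi> \<cdot> \<chi> = (\<psi> \<cdot> j) \<cdot> \<iota> k \<delta>"
    by (rule bij[OF k qf vertical_comp_left[OF \<iota> \<psi>j A]])
  show "\<exists>!\<chi>. \<chi> \<in> E (I A) Z X \<and> \<Phi> \<cdot> \<chi> = \<psi>"
  proof (rule ex_ex1I)
    obtain \<chi>' where \<chi>': "\<chi>' \<in> E k \<delta> X" "\<Phi> \<cdot> \<chi>' = (\<psi> \<cdot> j) \<cdot> \<iota> k \<delta>" using ex1 by blast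
    obtain \<chi> where \<chi>: "\<chi> \<in> E (I A) (Coprod k \<delta>) X" "\<chi> \<cdot> \<iota> k \<delta> = \<chi>'" using univ[OF \<chi>'(1)] by blast
    have "(\<Phi> \<cdot> \<chi>) \<cdot> \<iota> k \<delta> = (\<psi> \<cdot> j) \<cdot> \<iota> k \<delta>" using assoc[OF \<iota> \<chi>(1) \<Phi>] \<chi>(2) \<chi>'(2) by simp
    then have "\<Phi> \<cdot> \<chi> = \<psi> \<cdot> j"
      using univ[OF vertical_comp_left[OF \<iota> \<psi>j A]] \<psi>j vertical_comp_left[OF \<chi>(1) \<Phi> A] by blast
    then have "\<Phi> \<cdot> (\<chi> \<cdot> i) = \<psi>"
      using assoc[OF i(1) \<chi>(1) \<Phi>] assoc[OF i(1) j(1) \<psi>] j(2) id_right[OF \<psi>] by simp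
    then show "\<exists>\<chi>. \<chi> \<in> E (I A) Z X \<and> \<Phi> \<cdot> \<chi> = \<psi>" using vertical_comp_left[OF i(1) \<chi>(1) A] by blast
  next
    \<comment> \<open>The translation is injective: \<open>i\<close> undoes \<open>j\<close>, and
      arrows out of the coproduct are determined by their composite with its injection.\<close>
    have red: "\<chi> \<cdot> j \<in> E (I A) (Coprod k \<delta>) X \<and> (\<chi> \<cdot> j) \<cdot> \<iota> k \<delta> \<in> E k \<delta> X \<and>
        \<Phi> \<cdot> ((\<chi> \<cdot> j) \<cdot> \<iota> k \<delta>) = (\<psi> \<cdot> j) \<cdot> \<iota> k \<delta> \<and> (\<chi> \<cdot> j) \<cdot> i = \<chi>"
      if "\<chi> \<in> E (I A) Z X \<and> \<Phi> \<cdot> \<chi> = \<psi>" for \<chi>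
    proof -
      from that have \<chi>: "\<chi> \<in> E (I A) Z X" "\<Phi> \<cdot> \<chi> = \<psi>" by auto
      note \<chi>j = vertical_comp_left[OF j(1) \<chi>(1) A]
      show ?thesis
        using \<chi>j vertical_comp_left[OF \<iota> \<chi>j A] assoc[OF \<iota> \<chi>j \<Phi>] assoc[OF j(1) \<chi>(1) \<Phi>]
          assoc[OF i(1) j(1) \<chi>(1)] \<chi>(2) j(2) id_right[OF \<chi>(1)] by simp
    qed
    fix \<chi>1 \<chi>2 assume a: "\<chi>1 \<in> E (I A) Z X \<and> \<Phi> \<cdot> \<chi>1 = \<psi>" "\<chi>2 \<in> E (I A) Z X \<and> \<Phi> \<cdot> \<chi>2 = \<psi>"
    note r1 = red[OF a(1)] and r2 = red[OF a(2)]
    have eq: "(\<chi>1 \<cdot> j) \<cdot> \<iota> k \<delta> = (\<chi>2 \<cdot> j) \<cdot> \<iota> k \<delta>" using ex1 r1 r2 by blast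
    have "(\<chi>2 \<cdot> j) \<cdot> \<iota> k \<delta> \<in> E k \<delta> X" using r2 by blast
    then have "\<chi>1 \<cdot> j = \<chi>2 \<cdot> j" using univ[of "(\<chi>2 \<cdot> j) \<cdot> \<iota> k \<delta>" X] r1 r2 eq by blast
    then show "\<chi>1 = \<chi>2" using r1 r2 by metis
  qed
qed

section \<open>Distributing products over coproducts\<close>

text \<open>The cancellation half of pullback pasting: the square on \<open>h\<close> and
  \<open>g\<close> and the whole rectangle over \<open>h \<star> \<kappa>\<close> are pullbacks,
  hence so is the remaining square. It makes Beck--Chevalley for \<open>g'\<close> available at the
  \<kappa> coming from the dependent product.\<close>

lemma is_pullback_paste:
  assumes g: "g \<in> homB A S" and h: "h \<in> homB X S" and z: "z \<in> homB Z A" and g': "g' \<in> homB Z X"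
    and u: "u \<in> homB K D" and k': "k' \<in> homB K A" and \<kappa>: "\<kappa> \<in> homB D X" and w: "w \<in> homB K Z"
    and pbh: "is_pullback (Bas P) g h z g'" and pbk: "is_pullback (Bas P) (h \<star> \<kappa>) g u k'"
    and zw: "z \<star> w = k'" and gw: "g' \<star> w = \<kappa> \<star> u"
  shows "is_pullback (Bas P) \<kappa> g' u w"
proof -
  note D = base.homD(1-3)[OF g] base.homD(1-3)[OF h] base.homD(1-3)[OF z] base.homD(1-3)[OF g']
    base.homD(1-3)[OF u] base.homD(1-3)[OF k'] base.homD(1-3)[OF \<kappa>] base.homD(1-3)[OF w]
    base.homD(1-3)[OF base.Cmp_hom[OF \<kappa> h]]
  have uh: "\<exists>!m. m \<in> homB W Z \<and> z \<star> m = a \<and> g' \<star> m = b"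
    if "a \<in> homB W A" "b \<in> homB W X" "g \<star> a = h \<star> b" for W a b
    using pbh that by (simp add: is_pullback_def D)
  have uk: "\<exists>!m. m \<in> homB W K \<and> u \<star> m = a \<and> k' \<star> m = b"
    if "a \<in> homB W D" "b \<in> homB W A" "(h \<star> \<kappa>) \<star> a = g \<star> b" for W a b
    using pbk that by (simp add: is_pullback_def D)
  have gz: "g \<star> z = h \<star> g'" using pbh by (simp add: is_pullback_def)
  have "\<exists>!m. m \<in> homB W K \<and> u \<star> m = a \<and> w \<star> m = b"
    if a: "a \<in> homB W D" and b: "b \<in> homB W Z" and eq: "\<kappa> \<star> a = g' \<star> b" for W a b
  proof -
    have zb: "z \<star> b \<in> homB W A" and gb: "g' \<star> b \<in> homB W X" using base.Cmp_hom b z g' by blast+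
    have *: "g \<star> (z \<star> b) = h \<star> (g' \<star> b)"
      by (simp add: base.Cmp_assoc[OF b z g, symmetric] gz base.Cmp_assoc[OF b g' h])
    then have "(h \<star> \<kappa>) \<star> a = g \<star> (z \<star> b)" by (simp add: base.Cmp_assoc[OF a \<kappa> h] eq)
    note m = uk[OF a zb this]
    show ?thesis
    proof (rule ex_ex1I)
      obtain m where m: "m \<in> homB W K" "u \<star> m = a" "k' \<star> m = z \<star> b" using m by blast
      have "z \<star> (w \<star> m) = z \<star> b" using base.Cmp_assoc[OF m(1) w z] zw m by simp
      moreover have "g' \<star> (w \<star> m) = g' \<star> b"
        using base.Cmp_assoc[OF m(1) w g'] gw m base.Cmp_assoc[OF m(1) u \<kappa>] eq by simp
      ultimately have "w \<star> m = b" using uh[OF zb gb *] base.Cmp_hom[OF m(1) w] b by blast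
      then show "\<exists>m. m \<in> homB W K \<and> u \<star> m = a \<and> w \<star> m = b" using m by blast
    next
      fix m1 m2 assume "m1 \<in> homB W K \<and> u \<star> m1 = a \<and> w \<star> m1 = b" "m2 \<in> homB W K \<and> u \<star> m2 = a \<and> w \<star> m2 = b"
      moreover have "k' \<star> n = z \<star> (w \<star> n)" if "n \<in> homB W K" for n
        using base.Cmp_assoc[OF that w z] zw by simp
      ultimately show "m1 = m2" using m by metis
    qed
  qed
  then show ?thesis using u w gw by (simp add: is_pullback_def D)
qed

theorem prod_coprod_distrib:
  assumes enough: "enough_quantifier_free P \<F> \<Sigma>"
    and gF: "g \<in> \<F>" and g: "g \<in> homB A S"
    and fF: "f \<in> \<F>" and f: "f \<in> homB (p \<beta>) A"
    and dp: "is_dependent_product (Bas P) \<F> f g h z g' e"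
    and \<beta>: "\<beta> \<in> Obj (Tot P)"
  shows "isomorphic (fibre P S) (Prod g (Coprod f \<beta>)) (Coprod h (Prod g' (reindex_obj P e \<beta>)))"
proof -
  have hF: "h \<in> \<F>" and pbh: "is_pullback (Bas P) g h z g'"
    and e0: "e \<in> homB (Dom (Bas P) z) (Dom (Bas P) f)" and fe: "f \<star> e = z"
    and dp_univ: "\<And>h' z1' z2' e'. h' \<in> \<F> \<Longrightarrow> is_pullback (Bas P) g h' z1' z2' \<Longrightarrow>
        e' \<in> homB (Dom (Bas P) z1') (Dom (Bas P) f) \<Longrightarrow> f \<star> e' = z1' \<Longrightarrow>
        (\<exists>!(w, k). w \<in> homB (Dom (Bas P) z1') (Dom (Bas P) z) \<and> k \<in> homB (Dom (Bas P) h') (Dom (Bas P) h) \<and>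
           h \<star> k = h' \<and> e \<star> w = e' \<and> z \<star> w = z1' \<and> g' \<star> w = k \<star> z2')"
    using dp unfolding is_dependent_product_def by blast+
  define X where "X = Dom (Bas P) h"
  define Z where "Z = Dom (Bas P) z"
  have S: "S \<in> Obj (Bas P)" using base.homD[OF g] by simp
  have h: "h \<in> homB X S" using pbh base.homD[OF g] by (auto simp: is_pullback_def hom_def X_def)
  have z: "z \<in> homB Z A" and g': "g' \<in> homB Z X"
    using pbh base.homD[OF g] by (auto simp: is_pullback_def X_def Z_def)
  have gz: "g \<star> z = h \<star> g'" using pbh by (simp add: is_pullback_def)
  have pbg: "is_pullback (Bas P) h g g' z"
    using is_pullback_sym[OF pbh] .
  have g'F: "g' \<in> \<F>" by (rule pullback_stable[OF gF pbg])
  have e: "e \<in> homB Z (p \<beta>)" using e0 base.homD[OF f] by (simp add: Z_def)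
  note Le = lift[OF \<beta> e]
  let ?e\<beta> = "reindex_obj P e \<beta>"
  have g'e: "g' \<in> homB (p ?e\<beta>) X" using g' Le(4) by simp
  define \<Gamma> where "\<Gamma> = Prod g' ?e\<beta>"
  note \<Gamma> = prod_counit[OF g'F Le(3) g'e, folded \<Gamma>_def]
  have h\<Gamma>: "h \<in> homB (p \<Gamma>) S" and g'\<Gamma>: "g' \<in> homB Z (p \<Gamma>)" using h g' \<Gamma>(2) by simp_all
  note L\<Gamma> = lift[OF \<Gamma>(1) g'\<Gamma>]
  note F = coprod_unit[OF fF \<beta> f]
  have gC: "g \<in> homB (p (Coprod f \<beta>)) S" and zC: "z \<in> homB Z (p (Coprod f \<beta>))" using g z F(2) by simp_all
  define Y where "Y = Prod g (Coprod f \<beta>)"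
  note Y = prod_counit[OF gF F(1) gC, folded Y_def]
  note \<iota>h = coprod_unit[OF hF \<Gamma>(1) h\<Gamma>]
  \<comment> \<open>Evaluation of the product along \<open>g'\<close>, then the lift to \<beta>,
    then the coproduct injection. The composite lies over \<open>z\<close> because
    \<open>f \<star> e = z\<close>.\<close>
  define \<zeta>0 where "\<zeta>0 = (\<iota> f \<beta> \<cdot> Lift P e \<beta>) \<cdot> Counit (\<Pi> g') ?e\<beta>"
  have Zobj: "Z \<in> Obj (Bas P)" using base.homD[OF z] by simp
  have \<epsilon>': "Counit (\<Pi> g') ?e\<beta> \<in> E (I Z) (reindex_obj P g' \<Gamma>) ?e\<beta>" using \<Gamma>(3) Le(4) by simp
  have \<iota>e: "\<iota> f \<beta> \<cdot> Lift P e \<beta> \<in> E z ?e\<beta> (Coprod f \<beta>)" by (rule over_comp'[OF Le(1) F(4) fe])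
  have \<zeta>0: "\<zeta>0 \<in> E z (reindex_obj P g' \<Gamma>) (Coprod f \<beta>)"
    unfolding \<zeta>0_def by (rule vertical_comp_right[OF \<epsilon>' \<iota>e Zobj])
  \<comment> \<open>Undoing the transposition of \<zeta>0 across the pullback of \<open>h\<close>
    and \<open>g\<close> gives an arrow over \<open>h\<close>; the universal property of the
    coproduct along \<open>h\<close> then yields the vertical comparison arrow \<Phi>.\<close>
  obtain \<Phi>' where \<Phi>': "\<Phi>' \<in> E h \<Gamma> Y" "is_transpose g g' z \<Gamma> (Coprod f \<beta>) \<Phi>' \<zeta>0"
    using prod_base_change[OF gF gC F(1) pbg g'F h\<Gamma> g'\<Gamma> zC \<Gamma>(1) \<zeta>0] unfolding Y_def by blast
  obtain \<Phi> where \<Phi>: "\<Phi> \<in> E (I S) (Coprod h \<Gamma>) Y" "\<Phi> \<cdot> \<iota> h \<Gamma> = \<Phi>'"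
    using coprod_univ[OF hF h\<Gamma> \<Phi>'(1)] by blast
  obtain \<psi>0 where \<psi>0: "\<psi>0 \<in> E z (reindex_obj P g' \<Gamma>) (reindex_obj P g Y)"
    "Lift P g Y \<cdot> \<psi>0 = \<Phi>' \<cdot> Lift P g' \<Gamma>" "Counit (\<Pi> g) (Coprod f \<beta>) \<cdot> \<psi>0 = \<zeta>0"
    using \<Phi>'(2) unfolding is_transpose_def Y_def by blast
  have gY: "g \<in> homB A (p Y)" using g Y(2) by simp
  note LY = lift[OF Y(1) gY]
  \<comment> \<open>Postcomposition with \<open>\<Phi>'\<close> corresponds on transposes to
    following \<open>\<theta>'\<close> by the lift of \<open>e\<close> and the injection into the
    coproduct along \<open>f\<close>. The middle arrows of the two transposes compose to the witness
    \<open>\<psi>0 \<cdot> \<psi>\<close>.\<close>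
  have transpose_comp: "is_transpose g u k' \<delta> (Coprod f \<beta>) (\<Phi>' \<cdot> \<theta>) (\<iota> f \<beta> \<cdot> (Lift P e \<beta> \<cdot> \<theta>'))"
    if \<theta>: "\<theta> \<in> E \<kappa> \<delta> \<Gamma>" "is_transpose g' u w \<delta> ?e\<beta> \<theta> \<theta>'" and zw: "z \<star> w = k'"
      and u: "u \<in> homB K (p \<delta>)" for u k' \<delta> \<theta> \<theta>' \<kappa> w K
  proof -
    note Lu = lift[OF overD(4)[OF \<theta>(1)] u]
    obtain \<psi> where \<psi>: "\<psi> \<in> E w (reindex_obj P u \<delta>) (reindex_obj P g' \<Gamma>)"
      "Lift P g' \<Gamma> \<cdot> \<psi> = \<theta> \<cdot> Lift P u \<delta>" "Counit (\<Pi> g') ?e\<beta> \<cdot> \<psi> = \<theta>'"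
      using \<theta>(2) unfolding is_transpose_def \<Gamma>_def by blast
    have 1: "\<psi>0 \<cdot> \<psi> \<in> E k' (reindex_obj P u \<delta>) (reindex_obj P g Y)" by (rule over_comp'[OF \<psi>(1) \<psi>0(1) zw])
    have 2: "Lift P g Y \<cdot> (\<psi>0 \<cdot> \<psi>) = (\<Phi>' \<cdot> \<theta>) \<cdot> Lift P u \<delta>"
      by (simp add: assoc[OF \<psi>(1) \<psi>0(1) LY(1), symmetric] \<psi>0(2) assoc[OF \<psi>(1) L\<Gamma>(1) \<Phi>'(1)] \<psi>(2)
          assoc[OF Lu(1) \<theta>(1) \<Phi>'(1)])
    have \<theta>': "\<theta>' \<in> E w (reindex_obj P u \<delta>) ?e\<beta>"
      using vertical_comp_left[OF \<psi>(1) \<epsilon>' Zobj] \<psi>(3) by simp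
    have 3: "Counit (\<Pi> g) (Coprod f \<beta>) \<cdot> (\<psi>0 \<cdot> \<psi>) = \<iota> f \<beta> \<cdot> (Lift P e \<beta> \<cdot> \<theta>')"
      by (simp add: assoc[OF \<psi>(1) \<psi>0(1) Y(3), symmetric] \<psi>0(3) \<zeta>0_def assoc[OF \<psi>(1) \<epsilon>' \<iota>e] \<psi>(3)
          assoc[OF \<theta>' Le(1) F(4)])
    show ?thesis using 1 2 3 unfolding is_transpose_def Y_def by blast
  qed
  have "isomorphic (fibre P S) Y (Coprod h \<Gamma>)"
  proof (rule isomorphic_if_postcomp_bij_quantifier_free[OF enough \<Phi>(1) S])
    fix D k \<delta> \<psi>
    assume k: "k \<in> \<F>" "k \<in> homB D S" and qf: "quantifier_free P \<F> \<Sigma> D \<delta>" and \<psi>: "\<psi> \<in> E k \<delta> Y"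
    have \<delta>: "\<delta> \<in> Obj (Tot P)" "p \<delta> = D" using qf by (auto simp: quantifier_free_def)
    obtain u k' where pbu: "is_pullback (Bas P) k g u k'"
      using pullback_exists[OF gF, of k] base.homD[OF k(2)] base.homD[OF g] by auto
    define K where "K = Dom (Bas P) u"
    have uF: "u \<in> \<F>" by (rule pullback_stable[OF gF pbu])
    have u: "u \<in> homB K D" and k': "k' \<in> homB K A" and ku: "k \<star> u = g \<star> k'"
      using pbu base.homD[OF k(2)] base.homD[OF g] by (auto simp: is_pullback_def K_def)
    have pbk: "is_pullback (Bas P) g k k' u"
      using is_pullback_sym[OF pbu] .
    have u\<delta>: "u \<in> homB K (p \<delta>)" and k\<delta>: "k \<in> homB (p \<delta>) S" using u k \<delta> by simp_all
    have k'C: "k' \<in> homB K (p (Coprod f \<beta>))" using k' F(2) by simp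
    let ?\<delta> = "reindex_obj P u \<delta>"
    note L\<delta> = lift[OF \<delta>(1) u\<delta>]
    \<comment> \<open>This lets the transpose \<zeta> of \<psi> factor uniquely through the
      injection of \<beta>; the base arrow of the factor is the \<open>e'\<close> to be fed into the
      dependent product.\<close>
    have qs: "quantifier_splitting P \<F> \<Sigma> K ?\<delta>" using qf u by (auto simp: quantifier_free_def)
    note tr = transpose_exists[OF gF gC F(1) _ u\<delta> k'C ku, folded Y_def]
    obtain \<zeta> where \<zeta>: "is_transpose g u k' \<delta> (Coprod f \<beta>) \<psi> \<zeta>" using tr(1)[OF \<psi>] by blast
    have \<zeta>E: "\<zeta> \<in> E k' ?\<delta> (Coprod f \<beta>)" by (rule tr(2)[OF \<psi> \<zeta>])
    note split = splitting_factor[OF qs fF f \<beta> \<zeta>E]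
    obtain t where t: "t \<in> hom (Tot P) ?\<delta> \<beta>" "\<iota> f \<beta> \<cdot> t = \<zeta>" using split by blast
    define e' where "e' = FArr (Prj P) t"
    have tE: "t \<in> E e' ?\<delta> \<beta>" unfolding e'_def by (rule over_FArr[OF t(1)])
    have e': "e' \<in> homB K (p \<beta>)" using overD(2)[OF tE] L\<delta>(4) by simp
    have fe': "f \<star> e' = k'" using overD(3)[OF over_comp[OF tE F(4)]] overD(3)[OF \<zeta>E] t(2) by simp
    let ?R = "\<lambda>w \<kappa>. w \<in> homB K Z \<and> \<kappa> \<in> homB D X \<and> h \<star> \<kappa> = k \<and> e \<star> w = e' \<and> z \<star> w = k' \<and> g' \<star> w = \<kappa> \<star> u"
    \<comment> \<open>The universal property is applied with \<open>k\<close> in the role of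
      \<open>h'\<close>, which uses that the test arrow \<open>k\<close> is a display map. The
      pullback is the one chosen above with its legs exchanged.\<close>
    have "\<exists>!(w, \<kappa>). ?R w \<kappa>"
      using dp_univ[OF k(1) pbk _ fe'] e' base.homD[OF k'] base.homD[OF f] base.homD[OF k(2)]
      by (simp add: X_def Z_def)
    then obtain w \<kappa> where R: "?R w \<kappa>" and R': "\<forall>w' \<kappa>'. ?R w' \<kappa>' \<longrightarrow> w' = w \<and> \<kappa>' = \<kappa>"
      by (rule ex1_pairE)
    have w: "w \<in> homB K Z" and \<kappa>: "\<kappa> \<in> homB D X" using R by blast+
    obtain \<theta>' where \<theta>': "\<theta>' \<in> E w ?\<delta> ?e\<beta>" "Lift P e \<beta> \<cdot> \<theta>' = t"
      using lift_factor[OF tE _ e, of w] R L\<delta>(4) by metis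
    have pb\<kappa>: "is_pullback (Bas P) \<kappa> g' u w"
      using is_pullback_paste[OF g h z g' u k' \<kappa> w pbh] R pbu by simp
    have we: "w \<in> homB K (p ?e\<beta>)" and \<kappa>\<delta>: "\<kappa> \<in> homB (p \<delta>) X" using w Le(4) \<kappa> \<delta>(2) by simp_all
    note ex\<theta> = prod_base_change[OF g'F g'e Le(3) pb\<kappa> uF \<kappa>\<delta> u\<delta> we \<delta>(1) \<theta>'(1), folded \<Gamma>_def]
    obtain \<theta> where \<theta>: "\<theta> \<in> E \<kappa> \<delta> \<Gamma>" "is_transpose g' u w \<delta> ?e\<beta> \<theta> \<theta>'" using ex\<theta> by blast
    have \<Phi>\<iota>: "\<Phi> \<cdot> (\<iota> h \<Gamma> \<cdot> \<theta>) = \<Phi>' \<cdot> \<theta>" if "\<theta> \<in> hom (Tot P) \<delta> \<Gamma>" for \<theta>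
      using assoc[OF over_FArr[OF that] \<iota>h(4) \<Phi>(1)] \<Phi>(2) by simp
    show "\<exists>!\<chi>. \<chi> \<in> E k \<delta> (Coprod h \<Gamma>) \<and> \<Phi> \<cdot> \<chi> = \<psi>"
    proof (rule ex1I)
      have 1: "is_transpose g u k' \<delta> (Coprod f \<beta>) (\<Phi>' \<cdot> \<theta>) \<zeta>"
        using transpose_comp[OF \<theta> _ u\<delta>, of k'] R \<theta>'(2) t(2) by simp
      have "\<Phi>' \<cdot> \<theta> \<in> E k \<delta> Y" using over_comp'[OF \<theta>(1) \<Phi>'(1)] R by blast
      then have "\<Phi>' \<cdot> \<theta> = \<psi>"
        using prod_base_change[OF gF gC F(1) pbu uF k\<delta> u\<delta> k'C \<delta>(1) \<zeta>E, folded Y_def] \<psi> \<zeta> 1 by blast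
      moreover have "\<iota> h \<Gamma> \<cdot> \<theta> \<in> E k \<delta> (Coprod h \<Gamma>)" using over_comp'[OF \<theta>(1) \<iota>h(4)] R by blast
      ultimately show "\<iota> h \<Gamma> \<cdot> \<theta> \<in> E k \<delta> (Coprod h \<Gamma>) \<and> \<Phi> \<cdot> (\<iota> h \<Gamma> \<cdot> \<theta>) = \<psi>"
        using \<Phi>\<iota>[OF overD(1)[OF \<theta>(1)]] by simp
    next
      fix \<chi> assume \<chi>: "\<chi> \<in> E k \<delta> (Coprod h \<Gamma>) \<and> \<Phi> \<cdot> \<chi> = \<psi>"
      then have \<chi>E: "\<chi> \<in> E k \<delta> (Coprod h \<Gamma>)" by simp
      \<comment> \<open>For uniqueness the construction is retraced. As \<delta> is quantifier-free,
        \<chi> factors through the injection of \<Gamma>; projecting the factor gives a candidate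
        for \<kappa>, and the pullback \<open>Z\<close> then gives one for \<open>w\<close>.\<close>
      obtain \<theta>2 where \<theta>2: "\<theta>2 \<in> hom (Tot P) \<delta> \<Gamma>" "\<iota> h \<Gamma> \<cdot> \<theta>2 = \<chi>"
        using quantifier_free_factor[OF qf hF h\<Gamma> \<Gamma>(1) \<chi>E] by blast
      define \<kappa>2 where "\<kappa>2 = FArr (Prj P) \<theta>2"
      have \<theta>2E: "\<theta>2 \<in> E \<kappa>2 \<delta> \<Gamma>" unfolding \<kappa>2_def by (rule over_FArr[OF \<theta>2(1)])
      have \<kappa>2: "\<kappa>2 \<in> homB D X" using overD(2)[OF \<theta>2E] \<delta>(2) \<Gamma>(2) by simp
      have h\<kappa>2: "h \<star> \<kappa>2 = k"
        using overD(3)[OF over_comp[OF \<theta>2E \<iota>h(4)]] overD(3)[OF \<chi>E] \<theta>2(2) by simp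
      have \<kappa>2u: "\<kappa>2 \<star> u \<in> homB K X" by (rule base.Cmp_hom[OF u \<kappa>2])
      have "g \<star> k' = h \<star> (\<kappa>2 \<star> u)" using base.Cmp_assoc[OF u \<kappa>2 h] h\<kappa>2 ku by simp
      then obtain w2 where w2: "w2 \<in> homB K Z" "z \<star> w2 = k'" "g' \<star> w2 = \<kappa>2 \<star> u"
        using pbh k' \<kappa>2u base.homD[OF g] base.homD[OF h] unfolding is_pullback_def Z_def by blast
      have w2e: "w2 \<in> homB K (p ?e\<beta>)" using w2(1) Le(4) by simp
      note tr2 = transpose_exists[OF g'F g'e Le(3) _ u\<delta> w2e w2(3)[symmetric], folded \<Gamma>_def, OF \<theta>2E]
      obtain \<theta>2' where \<theta>2': "is_transpose g' u w2 \<delta> ?e\<beta> \<theta>2 \<theta>2'" using tr2(1) by blast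
      have \<theta>2'E: "\<theta>2' \<in> E w2 ?\<delta> ?e\<beta>" by (rule tr2(2)[OF \<theta>2'])
      have "\<Phi>' \<cdot> \<theta>2 = \<psi>" using \<Phi>\<iota>[OF \<theta>2(1)] \<theta>2(2) \<chi> by simp
      then have "\<iota> f \<beta> \<cdot> (Lift P e \<beta> \<cdot> \<theta>2') = \<zeta>"
        using transpose_comp[OF \<theta>2E \<theta>2' w2(2) u\<delta>] tr(1)[OF \<psi>] \<zeta> by auto
      moreover note L\<theta>2 = over_comp[OF \<theta>2'E Le(1)]
      ultimately have Lt: "Lift P e \<beta> \<cdot> \<theta>2' = t" using split t overD(1)[OF L\<theta>2] by blast
      then have "e \<star> w2 = e'" using overD(3)[OF L\<theta>2] overD(3)[OF tE] by simp
      \<comment> \<open>The candidates satisfy every condition of the dependent product for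
        \<open>e'\<close>, so its uniqueness identifies the base arrows. Cancelling the lift of
        \<open>e\<close> and uniqueness in \<open>prod_base_change\<close> then identify the arrows
        above them.\<close>
      then have eqs: "w2 = w" "\<kappa>2 = \<kappa>" using R'[rule_format, of w2 \<kappa>2] w2 \<kappa>2 h\<kappa>2 by auto
      have "\<theta>2' = \<theta>'"
        by (rule lift_cancel[OF \<beta> e, of _ w ?\<delta>]) (use \<theta>2'E eqs \<theta>' Lt in simp_all)
      then have "\<theta>2 = \<theta>" using ex\<theta> \<theta> \<theta>2E \<theta>2' eqs by blast
      then show "\<chi> = \<iota> h \<Gamma> \<cdot> \<theta>" using \<theta>2(2) by simp
    qed
  qed
  then show ?thesis by (simp add: Y_def \<Gamma>_def)
qed

end

theorem theorem4p18:
  fixes P :: "('bo, 'ba, 'eo, 'ea) fib"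
    and \<F> :: "'ba set"
    and \<Sigma> \<Pi> :: "'ba \<Rightarrow> ('eo, 'ea) adj"
    and A B S :: 'bo
    and f g h z g' e :: 'ba
    and \<beta> :: 'eo
  assumes "display_map_category_with_units (Bas P) \<F>"
    and "dependent_skolem_fibration P \<F> \<Sigma> \<Pi>"
    and "g \<in> \<F>" and "g \<in> hom (Bas P) A S"
    and "f \<in> \<F>" and "f \<in> hom (Bas P) B A"
    and "is_dependent_product (Bas P) \<F> f g h z g' e"
    and "\<beta> \<in> Obj (fibre P B)"
  shows "isomorphic (fibre P S)
           (FObj (Adj (\<Pi> g)) (FObj (Adj (\<Sigma> f)) \<beta>))
           (FObj (Adj (\<Sigma> h)) (FObj (Adj (\<Pi> g')) (reindex_obj P e \<beta>)))"
proof -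
  interpret base: display_map_category_with_units "Bas P" \<F> by fact
  interpret skolem: dependent_skolem_fibration P \<F> \<Sigma> \<Pi> by fact
  have "is_coproducts P \<F> \<Sigma>" using skolem.enough_qf by (simp add: enough_quantifier_free_def)
  then interpret fibration_with_quantifiers P \<F> \<Sigma> \<Pi>
    using skolem.products by unfold_locales
  show ?thesis
    using prod_coprod_distrib[OF skolem.enough_qf assms(3,4,5) _ assms(7)] assms(6,8) by simp
qed

end
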